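(* Consider the conditional expectation of the complete-data log-likelihood function for interval-censored multi-state data, $$\mathbb{E}[\ell^{\mathrm C}\mid \mathrm O,\widetilde\alpha]=\sum_{k=1}^K\sum_{(g,h)\in\mathcal V}\Big\{\mathbb{E}[d_{gh}^k\mid \mathrm O,\widetilde\alpha]\log(\alpha_{gh}^k)-\alpha_{gh}^k\,\mathbb{E}[Y_g^k\mid \mathrm O,\widetilde\alpha]\Big\}.$$ The conditional expectations for interval-censored multi-state data with transition times exactly known for a subset of states $\mathcal E\subseteq\mathcal H$ are given by $$d_{gh,i}^k(\widetilde\alpha):=\mathbb{E}[d_{gh,i}^k\mid \mathrm O,\widetilde\alpha]=\begin{cases}\dfrac{\widetilde P_{a_i^k,g}(l_i^k,\tau_{k-1})\cdot\widetilde\alpha_{gh}^k\cdot\widetilde P_{h,b_i^k}(\tau_k,r_i^k)}{\widetilde P_{a_i^k,b_i^k}(l_i^k,r_i^k)}, & \text{if } b_i^k\notin\mathcal E,\\[3ex] \dfrac{\widetilde P_{a_i^k,g}(l_i^k,\tau_{k-1})\cdot\widetilde\alpha_{gh}^k\cdot\sum_{m\in\mathcal R_{b_i^k}}\widetilde\alpha_{m b_i^k}^{k_{r_i}}\,\widetilde P_{h,m}(\tau_k,\tau_{k_{r_i}-1})}{\sum_{m\in\mathcal R_{b_i^k}}\widetilde\alpha_{m b_i^k}^{k_{r_i}}\,\widetilde P_{a_i^k,m}(l_i^k,\tau_{k_{r_i}-1})}, & \text{if } b_i^k\in\mathcal E,\end{cases}$$ $$Y_{g,i}^k(\widetilde\alpha):=\mathbb{E}[Y_{g,i}^k\mid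 \mathrm O,\widetilde\alpha]=\begin{cases}\dfrac{\widetilde P_{a_i^k,g}(l_i^k,\tau_{k-1})\cdot\widetilde P_{g,b_i^k}(\tau_k-,r_i^k)}{\widetilde P_{a_i^k,b_i^k}(l_i^k,r_i^k)}, & \text{if } b_i^k\notin\mathcal E,\\[3ex] \dfrac{\widetilde P_{a_i^k,g}(l_i^k,\tau_{k-1})\cdot\sum_{m\in\mathcal R_{b_i^k}}\widetilde\alpha_{m b_i^k}^{k_{r_i}}\,\widetilde P_{g,m}(\tau_{k-1},\tau_{k_{r_i}-1})}{\sum_{m\in\mathcal R_{b_i^k}}\widetilde\alpha_{m b_i^k}^{k_{r_i}}\,\widetilde P_{a_i^k,m}(l_i^k,\tau_{k_{r_i}-1})}, & \text{if } b_i^k\in\mathcal E,\end{cases}$$ with $k_{r_i}$ the index such that $\tau_{k_{r_i}}=r_i^k$, with $d_{gh}^k(\widetilde\alpha):=\mathbb E[d_{gh}^k\mid\mathrm O,\widetilde\alpha]=\sum_{i=1}^n d_{gh,i}^k(\widetilde\alpha)$ and $Y_g^k(\widetilde\alpha):=\mathbb E[Y_g^k\mid\mathrm O,\widetilde\alpha]=\sum_{i=1}^nY_{g,i}^k(\widetilde\alpha)$, and with $\widetilde{\mathbf P}(s,t)$ the product integral over $s<u\le t$ of $\mathbf I+\mathrm d\widetilde{\mathbf A}(u)$, where $\widetilde{\mathbf A}$ is the current estimate of the cumulative transition intensities.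
   Context: States and transitions: $\mathcal H=\{1,\dots,H\}$ is a finite state set and $\mathcal V\subseteq\mathcal H\times\mathcal H$ is the set of pairs $(g,h)$, $g\neq h$, for which a direct transition $g\to h$ is possible. The directed graph $(\mathcal H,\mathcal V)$ is acyclic (model without loops). For $h\in\mathcal H$, $\mathcal R_h=\{g\in\mathcal H:(g,h)\in\mathcal V\}$ is the set of states from which $h$ is directly reachable. Observed data: subjects $i=1,\dots,n$ follow independent realisations $X_i$ of a (time non-homogeneous) Markov process on $\mathcal H$. Subject $i$ is observed at times $t_{i0}<t_{i1}<\dots<t_{in_i}$ in states $x_{ij}=X_i(t_{ij})$. The visit process is conditionally independent: given the history up to the last visit, the next visit time is independent of the process after the last visit. Censoring is independent. $\mathrm O$ denotes the observed data of all subjects. The set $\mathcal E\subseteq\mathcal H$ is fixed and known, and transitions into states of $\mathcal E$ are observed at exact times: an observation $(x_{ij},t_{ij})$ with $x_{ij}\in\mathcal E$ means that the transition into $x_{ij}$ happened at $t_{ij}$, so that $X_i(t_{ij}-)\in\mathcal R_{x_{ij}}$. The observed data are assumed to have positive probability under $\widetilde\alpha$ (introduced below). Time grid: $0=\tau_0<\tau_1<\dots<\tau_K<\infty$ are the sorted unique observation times of all subjects; $(\tau_{k-1},\tau_k]$ is called bin $k$. For given $k$ and $i$, $l_i^k=\max_j\{t_{ij}: t_{ij}\le\tau_{k-1}\}$ and $r_i^k=\min_j\{t_{ij}: t_{ij}\ge\tau_k\}$, so that $(l_i^k,r_i^k]$ is the observational interval of subject $i$ containing bin $k$; $a_i^k=X_i(l_i^k)$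 and $b_i^k=X_i(r_i^k)$ are the states observed at its ends. Parameters: the cumulative intensities $A_{gh}$ are restricted to right-continuous step functions jumping only at $\tau_1,\dots,\tau_K$, with jump $\alpha_{gh}^k$ at $\tau_k$, where $\alpha_{gh}^k\ge0$, $\sum_{h\ne g}\alpha_{gh}^k\le1$, and $\alpha_{gh}^k=0$ if $(g,h)\notin\mathcal V$. $\alpha=(\alpha_{gh}^k)$ is the array of jumps and $\widetilde\alpha=(\widetilde\alpha_{gh}^k)$ is the current estimate, satisfying the same constraints, with corresponding cumulative intensity matrix $\widetilde{\mathbf A}$ (off-diagonal entries $\widetilde A_{gh}$, diagonal entries $\widetilde A_{gg}=-\sum_{h\ne g}\widetilde A_{gh}$). Then $$\widetilde{\mathbf P}(s,t)=\prod_{k:\,s<\tau_k\le t}\big(\mathbf I+\Delta\widetilde{\mathbf A}(\tau_k)\big),$$ the product ordered with time increasing from left to right, an empty product being $\mathbf I$, and $\Delta\widetilde{\mathbf A}(\tau_k)$ being the jump of $\widetilde{\mathbf A}$ at $\tau_k$. Its $(g,h)$ entry $\widetilde P_{g,h}(s,t)$ is the transition probability $\mathbb P(X(t)=h\mid X(s)=g)$ under $\widetilde\alpha$. The notation $\tau_k-$ means just before $\tau_k$; since jumps occur only at grid times, $\widetilde P_{g,h}(\tau_k-,t)=\widetilde P_{g,h}(\tau_{k-1},t)$. Counts: $d_{gh,i}^k=\mathbf 1\{X_i(\tau_k-)=g,\ X_i(\tau_k)=h\}$, $Y_{g,i}^k=\mathbf 1\{X_i(\tau_k-)=g\}$, $d_{gh}^k=\sum_{i=1}^n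 d_{gh,i}^k$ and $Y_g^k=\sum_{i=1}^nY_{g,i}^k$. The complete-data log-likelihood (discretised to the grid) is $\ell^{\mathrm C}=\sum_{k=1}^K\sum_{(g,h)\in\mathcal V}\{d_{gh}^k\log(\alpha_{gh}^k)-\alpha_{gh}^kY_g^k\}$.
   Formalization: For b∈E and k=k_r the numerator sum in d is replaced by 1{h=b}. Given the observed history, visit times are independent of the whole process, not only its future. Observing b∈E at t>0 means only X(t)=b, X(t-)∈R_b; unobserved entries into E are not excluded. *)

theory Defs
  imports "HOL-Probability.Probability"
begin

section \<open>Step-function intensities and the product integral\<close>

text \<open>The states are the elements of a finite type. The value \<open>\<alpha> k g h\<close> is the jump at the grid time
  \<open>\<tau> k\<close> of the cumulative intensity of the transition from \<open>g\<close> to \<open>h\<close>; only \<open>1 \<le> k \<le> K\<close> matters.\<close>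

type_synonym 's jumps = "nat \<Rightarrow> 's \<Rightarrow> 's \<Rightarrow> real"

definition valid_jumps :: "('s::finite \<times> 's) set \<Rightarrow> nat \<Rightarrow> 's jumps \<Rightarrow> bool" where
  "valid_jumps V K \<alpha> \<longleftrightarrow>
     (\<forall>k\<in>{1..K}. \<forall>g. (\<forall>h. 0 \<le> \<alpha> k g h) \<and> (\<Sum>h\<in>UNIV - {g}. \<alpha> k g h) \<le> 1
        \<and> (\<forall>h. (g, h) \<notin> V \<longrightarrow> \<alpha> k g h = 0))"

definition reach :: "('s \<times> 's) set \<Rightarrow> 's \<Rightarrow> 's set" where
  "reach V h = {g. (g, h) \<in> V}"

definition cum_intensity :: "(nat \<Rightarrow> real) \<Rightarrow> nat \<Rightarrow> 's jumps \<Rightarrow> 's \<Rightarrow> 's \<Rightarrow> real \<Rightarrow> real" where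
  "cum_intensity \<tau> K \<alpha> g h t = (\<Sum>k\<in>{k\<in>{1..K}. \<tau> k \<le> t}. \<alpha> k g h)"

definition cum_intensity_matrix ::
  "(nat \<Rightarrow> real) \<Rightarrow> nat \<Rightarrow> 's::finite jumps \<Rightarrow> real \<Rightarrow> real^'s^'s" where
  "cum_intensity_matrix \<tau> K \<alpha> t =
     (\<chi> g h. if g = h then - (\<Sum>h'\<in>UNIV - {g}. cum_intensity \<tau> K \<alpha> g h' t)
            else cum_intensity \<tau> K \<alpha> g h t)"

definition jump_at :: "(real \<Rightarrow> 'a::real_normed_vector) \<Rightarrow> real \<Rightarrow> 'a" where
  "jump_at A t = A t - Lim (at_left t) A"

text \<open>The factors stand in the order of increasing time from left to right. The product is the
  identity if there is no grid time in \<open>(s, t]\<close>, in particular if \<open>t \<le> s\<close>.\<close>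

definition trans_prob ::
  "(nat \<Rightarrow> real) \<Rightarrow> nat \<Rightarrow> 's::finite jumps \<Rightarrow> real \<Rightarrow> real \<Rightarrow> real^'s^'s" where
  "trans_prob \<tau> K \<alpha> s t =
     foldr (**) (map (\<lambda>k. mat 1 + jump_at (cum_intensity_matrix \<tau> K \<alpha>) (\<tau> k))
                     (filter (\<lambda>k. s < \<tau> k \<and> \<tau> k \<le> t) [1..<Suc K]))
           (mat 1)"


section \<open>Markov processes with a finite state space\<close>

text \<open>A path is a function on the time axis \<open>[0, \<infinity>)\<close>; its values at negative times are irrelevant.
  Convergence in the finite state space is eventual constancy.\<close>

definition cadlag_path :: "(real \<Rightarrow> 's) \<Rightarrow> bool" where
  "cadlag_path f \<longleftrightarrow>
     (\<forall>t\<ge>0. eventually (\<lambda>u. f u = f t) (at_right t)) \<and>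
     (\<forall>t>0. \<exists>s. eventually (\<lambda>u. f u = s) (at_left t))"

definition left_state :: "(real \<Rightarrow> 's) \<Rightarrow> real \<Rightarrow> 's" where
  "left_state f t = (THE s. eventually (\<lambda>u. f u = s) (at_left t))"

text \<open>Markov property with transition probabilities \<open>P s t $ g $ h\<close>. The initial distribution is
  left arbitrary.\<close>

definition markov_process ::
  "'w measure \<Rightarrow> (real \<Rightarrow> 'w \<Rightarrow> 's::finite) \<Rightarrow> (real \<Rightarrow> real \<Rightarrow> real^'s^'s) \<Rightarrow> bool" where
  "markov_process M X P \<longleftrightarrow>
     (\<forall>t\<ge>0. X t \<in> measurable M (count_space UNIV)) \<and>
     (\<forall>\<omega>\<in>space M. cadlag_path (\<lambda>t. X t \<omega>)) \<and>
     (\<forall>(m::nat) (s::nat \<Rightarrow> real) (y::nat \<Rightarrow> 's) u h.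
        0 \<le> s 0 \<longrightarrow> (\<forall>q<m. s q < s (Suc q)) \<longrightarrow> s m < u \<longrightarrow>
        0 < \<P>(\<omega> in M. \<forall>q\<le>m. X (s q) \<omega> = y q) \<longrightarrow>
        \<P>(\<omega> in M. X u \<omega> = h \<bar> \<forall>q\<le>m. X (s q) \<omega> = y q) = P (s m) u $ y m $ h)"

definition process_events :: "'w measure \<Rightarrow> (real \<Rightarrow> 'w \<Rightarrow> 's) \<Rightarrow> 'w set set" where
  "process_events M X = sigma_sets (space M) {{\<omega>\<in>space M. X t \<omega> = h} | t h. 0 \<le> t}"


section \<open>Visits and observed data of one subject\<close>

text \<open>The data of one subject are the times \<open>t 0 < \<dots> < t N\<close> and the states \<open>x 0, \<dots>, x N\<close>.
  The random variable \<open>W j\<close> is the time scheduled for the \<open>j\<close>th visit, chosen after observation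
  \<open>j - 1\<close>; the value \<open>\<infinity>\<close> means that follow-up ends (censoring). An observation in a state outside
  \<open>E\<close> is made at the scheduled visit. An observation in a state of \<open>E\<close> is made at the time of the
  transition into that state, which must not be later than the scheduled visit. At time 0, where the
  process starts, there is no transition to observe. The event contains no further information on
  the path between two consecutive observations.\<close>

definition obs_event ::
  "('s \<times> 's) set \<Rightarrow> 's set \<Rightarrow> (real \<Rightarrow> 'w \<Rightarrow> 's) \<Rightarrow> (nat \<Rightarrow> 'w \<Rightarrow> ereal) \<Rightarrow>
   (nat \<Rightarrow> real) \<Rightarrow> (nat \<Rightarrow> 's) \<Rightarrow> nat \<Rightarrow> 'w \<Rightarrow> bool" where
  "obs_event V E X W t x j \<omega> \<longleftrightarrow>
     X (t j) \<omega> = x j \<and>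
     (if x j \<in> E \<and> 0 < t j
      then left_state (\<lambda>u. X u \<omega>) (t j) \<in> reach V (x j) \<and> ereal (t j) \<le> W j \<omega>
      else W j \<omega> = ereal (t j))"

definition obs_history ::
  "'w measure \<Rightarrow> ('s \<times> 's) set \<Rightarrow> 's set \<Rightarrow> (real \<Rightarrow> 'w \<Rightarrow> 's) \<Rightarrow> (nat \<Rightarrow> 'w \<Rightarrow> ereal) \<Rightarrow>
   (nat \<Rightarrow> real) \<Rightarrow> (nat \<Rightarrow> 's) \<Rightarrow> nat \<Rightarrow> 'w set" where
  "obs_history M V E X W t x m = {\<omega>\<in>space M. \<forall>j<m. obs_event V E X W t x j \<omega>}"

definition obs_subject ::
  "'w measure \<Rightarrow> ('s \<times> 's) set \<Rightarrow> 's set \<Rightarrow> (real \<Rightarrow> 'w \<Rightarrow> 's) \<Rightarrow> (nat \<Rightarrow> 'w \<Rightarrow> ereal) \<Rightarrow>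
   nat \<Rightarrow> (nat \<Rightarrow> real) \<Rightarrow> (nat \<Rightarrow> 's) \<Rightarrow> 'w set" where
  "obs_subject M V E X W N t x =
     {\<omega>\<in>obs_history M V E X W t x (Suc N). W (Suc N) \<omega> = \<infinity>}"

text \<open>Conditionally independent visits and independent censoring: given the observed history up to
  observation \<open>j - 1\<close>, the time scheduled for the next visit (or the end of follow-up) is independent
  of the process. Independence of the process after observation \<open>j - 1\<close> alone would not suffice:
  the choice of a visit time could then reveal the path between two earlier observations.\<close>

definition cond_indep_visits ::
  "'w measure \<Rightarrow> ('s \<times> 's) set \<Rightarrow> 's set \<Rightarrow> (real \<Rightarrow> 'w \<Rightarrow> 's) \<Rightarrow> (nat \<Rightarrow> 'w \<Rightarrow> ereal) \<Rightarrow>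
   nat \<Rightarrow> (nat \<Rightarrow> real) \<Rightarrow> (nat \<Rightarrow> 's) \<Rightarrow> bool" where
  "cond_indep_visits M V E X W N t x \<longleftrightarrow>
     (\<forall>j\<le>Suc N. W j \<in> borel_measurable M \<and>
        (let H = obs_history M V E X W t x j in
         0 < measure M H \<longrightarrow>
         prob_space.indep_set (uniform_measure M H)
           {W j -` B \<inter> space M | B. B \<in> sets borel} (process_events M X)))"

definition subject_events ::
  "'w measure \<Rightarrow> (real \<Rightarrow> 'w \<Rightarrow> 's) \<Rightarrow> (nat \<Rightarrow> 'w \<Rightarrow> ereal) \<Rightarrow> nat \<Rightarrow> 'w set set" where
  "subject_events M X W N =
     sigma_sets (space M)
       ({{\<omega>\<in>space M. X t \<omega> = h} | t h. 0 \<le> t} \<union>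
        {W j -` B \<inter> space M | j B. j \<le> Suc N \<and> B \<in> sets borel})"


section \<open>Observational intervals\<close>

definition left_end :: "(nat \<Rightarrow> real) \<Rightarrow> nat \<Rightarrow> (nat \<Rightarrow> real) \<Rightarrow> nat \<Rightarrow> real" where
  "left_end \<tau> N t k = Max {t j | j. j \<le> N \<and> t j \<le> \<tau> (k - 1)}"

definition right_end :: "(nat \<Rightarrow> real) \<Rightarrow> nat \<Rightarrow> (nat \<Rightarrow> real) \<Rightarrow> nat \<Rightarrow> real" where
  "right_end \<tau> N t k = Min {t j | j. j \<le> N \<and> \<tau> k \<le> t j}"

definition state_at :: "nat \<Rightarrow> (nat \<Rightarrow> real) \<Rightarrow> (nat \<Rightarrow> 's) \<Rightarrow> real \<Rightarrow> 's" where
  "state_at N t x s = x (THE j. j \<le> N \<and> t j = s)"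

definition grid_index :: "(nat \<Rightarrow> real) \<Rightarrow> nat \<Rightarrow> real \<Rightarrow> nat" where
  "grid_index \<tau> K s = (THE k. k \<le> K \<and> \<tau> k = s)"


section \<open>Counts, likelihood and conditional expectation\<close>

definition trans_count :: "(nat \<Rightarrow> real) \<Rightarrow> (real \<Rightarrow> 'w \<Rightarrow> 's) \<Rightarrow> nat \<Rightarrow> 's \<Rightarrow> 's \<Rightarrow> 'w \<Rightarrow> real" where
  "trans_count \<tau> X k g h \<omega> = of_bool (left_state (\<lambda>u. X u \<omega>) (\<tau> k) = g \<and> X (\<tau> k) \<omega> = h)"

definition at_risk :: "(nat \<Rightarrow> real) \<Rightarrow> (real \<Rightarrow> 'w \<Rightarrow> 's) \<Rightarrow> nat \<Rightarrow> 's \<Rightarrow> 'w \<Rightarrow> real" where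
  "at_risk \<tau> X k g \<omega> = of_bool (left_state (\<lambda>u. X u \<omega>) (\<tau> k) = g)"

definition total_count ::
  "(nat \<Rightarrow> real) \<Rightarrow> nat \<Rightarrow> (nat \<Rightarrow> real \<Rightarrow> 'w \<Rightarrow> 's) \<Rightarrow> nat \<Rightarrow> 's \<Rightarrow> 's \<Rightarrow> 'w \<Rightarrow> real" where
  "total_count \<tau> n X k g h \<omega> = (\<Sum>i=1..n. trans_count \<tau> (X i) k g h \<omega>)"

definition total_at_risk ::
  "(nat \<Rightarrow> real) \<Rightarrow> nat \<Rightarrow> (nat \<Rightarrow> real \<Rightarrow> 'w \<Rightarrow> 's) \<Rightarrow> nat \<Rightarrow> 's \<Rightarrow> 'w \<Rightarrow> real" where
  "total_at_risk \<tau> n X k g \<omega> = (\<Sum>i=1..n. at_risk \<tau> (X i) k g \<omega>)"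

text \<open>Jumps \<open>\<alpha> k g h = 0\<close> are allowed, so the logarithm takes the value \<open>-\<infinity>\<close> there (the library's
  \<open>ln 0\<close> is \<open>0\<close>) and the log-likelihood is extended real. In \<open>ereal\<close>, \<open>0 * (-\<infinity>) = 0\<close>.\<close>

definition ext_ln :: "real \<Rightarrow> ereal" where
  "ext_ln a = (if 0 < a then ereal (ln a) else -\<infinity>)"

definition complete_loglik ::
  "('s::finite \<times> 's) set \<Rightarrow> (nat \<Rightarrow> real) \<Rightarrow> nat \<Rightarrow> nat \<Rightarrow> (nat \<Rightarrow> real \<Rightarrow> 'w \<Rightarrow> 's) \<Rightarrow> 's jumps \<Rightarrow>
   'w \<Rightarrow> ereal" where
  "complete_loglik V \<tau> K n X \<alpha> \<omega> =
     (\<Sum>k=1..K. \<Sum>(g, h)\<in>V. ereal (total_count \<tau> n X k g h \<omega>) * ext_ln (\<alpha> k g h)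
        - ereal (\<alpha> k g h * total_at_risk \<tau> n X k g \<omega>))"

definition ereal_expectation :: "'w measure \<Rightarrow> ('w \<Rightarrow> ereal) \<Rightarrow> ereal" where
  "ereal_expectation M f =
     enn2ereal (\<integral>\<^sup>+\<omega>. e2ennreal (f \<omega>) \<partial>M) - enn2ereal (\<integral>\<^sup>+\<omega>. e2ennreal (- f \<omega>) \<partial>M)"

text \<open>Conditional expectations given an event of positive probability.\<close>

definition cond_expect :: "'w measure \<Rightarrow> 'w set \<Rightarrow> ('w \<Rightarrow> real) \<Rightarrow> real" where
  "cond_expect M B f = integral\<^sup>L (uniform_measure M B) f"

definition ereal_cond_expect :: "'w measure \<Rightarrow> 'w set \<Rightarrow> ('w \<Rightarrow> ereal) \<Rightarrow> ereal" where
  "ereal_cond_expect M B f = ereal_expectation (uniform_measure M B) f"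

end

theory Submission
  imports Defs
begin

text \<open>Between two grid times the process is almost surely constant, since there the product integral is
  the identity. So the left limit at \<open>\<tau> k\<close> is almost surely the state at \<open>\<tau> (k - 1)\<close>, and
  \<open>k \<mapsto> X (\<tau> k)\<close> is a Markov chain with transition matrices \<open>I + \<Delta>A(\<tau> k)\<close>. The observations of a
  subject, as well as a transition or a state at risk in bin \<open>k\<close>, restrict only pairs of successive
  states of this chain; the probability of such an event is a product of the transition matrices with
  the forbidden entries set to 0. Because the states at both ends of an observational interval are
  fixed, the factors outside the interval cancel in the conditional probability. Visit times do not
  matter: given the history, each visit contributes a factor that does not depend on the path. The
  other subjects drop out by independence.\<close>

section \<open>Product integrals on the grid\<close>

text \<open>The Markov property is available only for events that prescribe the state at each of
  finitely many times. Two reductions bring other events within its reach: a left limit is read off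
  along one sequence of times, so countably many null sets suffice, and an event of the past on the
  grid is split into the finitely many paths that satisfy it. Pairs of successive states are the
  right unit, because a visit in \<open>E\<close> and a transition in a bin both involve the state
  just before a grid time as well as the state at it.

  The last bin of an interval that ends in \<open>E\<close> has its own formula. The transition
  counted there is the observed one, so the factor for the future is 1 if \<open>h = b\<close> and 0
  otherwise. A sum over \<open>reach V b\<close> with times running backwards from
  \<open>\<tau> k\<close> to \<open>\<tau> (k - 1)\<close> would contain an empty product, the
  identity, and give \<open>\<alpha>' k h b\<close> for \<open>h\<close> in
  \<open>reach V b\<close>.

  The log-likelihood may be \<open>-\<infinity>\<close>. As jumps are at most 1, all its terms are
  nonpositive, so its expectation is minus a nonnegative integral and no difference of infinities
  arises.\<close>

lemma sum_supported_at:
  fixes f g :: "'a::finite \<Rightarrow> real"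
  assumes "\<And>u. u \<noteq> a \<Longrightarrow> f u = 0"
  shows "(\<Sum>u\<in>UNIV. f u * g u) = f a * g a"
  using assms by (simp add: sum.remove[of UNIV a])

text \<open>Factors with index in \<open>(i, j]\<close>, like the product integral over
  \<open>(\<tau> i, \<tau> j]\<close>, so that adjacent ranges compose without an index
  shift.\<close>

definition mat_prod :: "(nat \<Rightarrow> real^'s^'s) \<Rightarrow> nat \<Rightarrow> nat \<Rightarrow> real^'s^'s::finite" where
  "mat_prod F i j = foldr (**) (map F [Suc i..<Suc j]) (mat 1)"

lemma foldr_matrix_mult:
  fixes A :: "real^'s^'s::finite"
  shows "foldr (**) Fs A = foldr (**) Fs (mat 1) ** A"
  by (induction Fs) (simp_all add: matrix_mul_assoc)

lemma mat_prod_same [simp]: "mat_prod F i i = mat 1"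
  by (simp add: mat_prod_def)

lemma mat_prod_append:
  assumes "i \<le> j" "j \<le> k"
  shows "mat_prod F i k = mat_prod F i j ** mat_prod F j k"
proof -
  have "[Suc i..<Suc k] = [Suc i..<Suc j] @ [Suc j..<Suc k]"
    using assms upt_add_eq_append[of "Suc i" "Suc j" "k - j"] by simp
  then show ?thesis
    by (simp only: mat_prod_def map_append foldr_append foldr_matrix_mult[symmetric])
qed

lemma mat_prod_single: "0 < k \<Longrightarrow> mat_prod F (k - 1) k = F k"
  by (cases k) (simp_all add: mat_prod_def)

lemma mat_prod_Suc: "i \<le> j \<Longrightarrow> mat_prod F i (Suc j) = mat_prod F i j ** F (Suc j)"
  using mat_prod_append[of i j "Suc j" F] mat_prod_single[of "Suc j" F] by simp

lemma mat_prod_cong: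
  assumes "\<And>k. i < k \<Longrightarrow> k \<le> j \<Longrightarrow> F k = G k"
  shows "mat_prod F i j = mat_prod G i j"
proof -
  have "map F [Suc i..<Suc j] = map G [Suc i..<Suc j]"
    using assms by (intro map_cong) auto
  then show ?thesis by (simp only: mat_prod_def)
qed

locale time_grid =
  fixes \<tau> :: "nat \<Rightarrow> real" and K :: nat
  assumes grid_start: "\<tau> 0 = 0" and grid_strict_mono: "strict_mono_on {0..K} \<tau>"
begin

lemma grid_less_iff: "i \<le> K \<Longrightarrow> j \<le> K \<Longrightarrow> \<tau> i < \<tau> j \<longleftrightarrow> i < j"
  using strict_mono_on_less[OF grid_strict_mono] by simp

lemma grid_le_iff: "i \<le> K \<Longrightarrow> j \<le> K \<Longrightarrow> \<tau> i \<le> \<tau> j \<longleftrightarrow> i \<le> j"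
  using strict_mono_on_less_eq[OF grid_strict_mono] by simp

lemma grid_eq_iff: "i \<le> K \<Longrightarrow> j \<le> K \<Longrightarrow> \<tau> i = \<tau> j \<longleftrightarrow> i = j"
  by (metis grid_le_iff order.eq_iff)

lemma grid_nonneg: "k \<le> K \<Longrightarrow> 0 \<le> \<tau> k"
  using grid_le_iff[of 0 k] grid_start by simp

lemma grid_index_eq: "k \<le> K \<Longrightarrow> grid_index \<tau> K (\<tau> k) = k"
  unfolding grid_index_def by (rule the_equality) (auto simp: grid_eq_iff)

lemma grid_prev_less: "k \<in> {1..K} \<Longrightarrow> \<tau> (k - 1) < \<tau> k"
  by (subst grid_less_iff) auto

lemma grid_pos: "k \<in> {1..K} \<Longrightarrow> 0 < \<tau> k"
  using grid_less_iff[of 0 k] grid_start by simp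

lemma cum_intensity_eq:
  assumes "j \<le> K" "\<tau> j \<le> u" "j < K \<Longrightarrow> u < \<tau> (Suc j)"
  shows "cum_intensity \<tau> K \<alpha> g h u = (\<Sum>k=1..j. \<alpha> k g h)"
proof -
  have "{k\<in>{1..K}. \<tau> k \<le> u} = {1..j}"
  proof (intro set_eqI iffI)
    fix k assume k: "k \<in> {k\<in>{1..K}. \<tau> k \<le> u}"
    have "k \<le> j"
    proof (rule ccontr)
      assume "\<not> k \<le> j"
      then have "j < K" "\<tau> (Suc j) \<le> \<tau> k" using k by (auto simp: grid_le_iff)
      then show False using assms(3) k by auto
    qed
    then show "k \<in> {1..j}" using k by simp
  next
    fix k assume k: "k \<in> {1..j}"
    then have "\<tau> k \<le> \<tau> j" using assms by (simp add: grid_le_iff)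
    then show "k \<in> {k\<in>{1..K}. \<tau> k \<le> u}" using k assms by auto
  qed
  then show ?thesis by (simp add: cum_intensity_def)
qed

text \<open>The matrix is constant from \<open>\<tau> (k - 1)\<close> up to, but excluding,
  \<open>\<tau> k\<close>. Its left limit at \<open>\<tau> k\<close> is therefore its value at
  \<open>\<tau> (k - 1)\<close>, and the difference consists of the \<open>k\<close>th summand
  alone.\<close>

lemma jump_cum_intensity_matrix:
  assumes k: "k \<in> {1..K}"
  shows "jump_at (cum_intensity_matrix \<tau> K \<alpha>) (\<tau> k) $ g $ h =
    (if g = h then - (\<Sum>h'\<in>UNIV - {g}. \<alpha> k g h') else \<alpha> k g h)"
proof -
  let ?A = "cum_intensity_matrix \<tau> K \<alpha>"
  have before: "cum_intensity \<tau> K \<alpha> g h u = (\<Sum>i=1..k-1. \<alpha> i g h)"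
    if "\<tau> (k - 1) \<le> u" "u < \<tau> k" for u g h
    using that k by (intro cum_intensity_eq) auto
  have at: "cum_intensity \<tau> K \<alpha> g h (\<tau> k) = (\<Sum>i=1..k-1. \<alpha> i g h) + \<alpha> k g h" for g h
  proof -
    have "cum_intensity \<tau> K \<alpha> g h (\<tau> k) = (\<Sum>i=1..k. \<alpha> i g h)"
      using k by (intro cum_intensity_eq) (auto simp: grid_less_iff)
    also have "{1..k} = insert k {1..k-1}" using k by auto
    finally show ?thesis using k by (auto simp: add.commute)
  qed
  have "eventually (\<lambda>u. ?A u = ?A (\<tau> (k - 1))) (at_left (\<tau> k))"
    using eventually_at_left_real[OF grid_prev_less[OF k]]
    by eventually_elim
      (use grid_prev_less[OF k] in \<open>simp add: cum_intensity_matrix_def before cong: if_cong\<close>)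
  then have "(?A \<longlongrightarrow> ?A (\<tau> (k - 1))) (at_left (\<tau> k))"
    by (rule tendsto_eventually)
  then have "Lim (at_left (\<tau> k)) ?A = ?A (\<tau> (k - 1))"
    by (intro tendsto_Lim) simp_all
  then show ?thesis
    using grid_prev_less[OF k]
    by (simp add: jump_at_def cum_intensity_matrix_def before at sum.distrib)
qed

definition step_factor :: "'s::finite jumps \<Rightarrow> nat \<Rightarrow> real^'s^'s" where
  "step_factor \<alpha> k = mat 1 + jump_at (cum_intensity_matrix \<tau> K \<alpha>) (\<tau> k)"

lemma step_factor_offdiag:
  "k \<in> {1..K} \<Longrightarrow> g \<noteq> h \<Longrightarrow> step_factor \<alpha> k $ g $ h = \<alpha> k g h"
  by (simp add: step_factor_def jump_cum_intensity_matrix mat_def)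

lemma trans_prob_grid:
  assumes "i \<le> j" "j \<le> K"
  shows "trans_prob \<tau> K \<alpha> (\<tau> i) (\<tau> j) = mat_prod (step_factor \<alpha>) i j"
proof -
  have *: "[1..<Suc K] = [1..<Suc i] @ [Suc i..<Suc j] @ [Suc j..<Suc K]"
    using assms upt_add_eq_append[of 1 "Suc i" "K - i"] upt_add_eq_append[of "Suc i" "Suc j" "K - j"]
    by (simp del: upt_Suc)
  have "filter (\<lambda>k. \<tau> i < \<tau> k \<and> \<tau> k \<le> \<tau> j) [1..<Suc i] = []"
    "filter (\<lambda>k. \<tau> i < \<tau> k \<and> \<tau> k \<le> \<tau> j) [Suc i..<Suc j] = [Suc i..<Suc j]"
    "filter (\<lambda>k. \<tau> i < \<tau> k \<and> \<tau> k \<le> \<tau> j) [Suc j..<Suc K] = []"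
    using assms by (auto simp: filter_empty_conv filter_id_conv grid_less_iff grid_le_iff simp del: upt_Suc)
  then have "filter (\<lambda>k. \<tau> i < \<tau> k \<and> \<tau> k \<le> \<tau> j) [1..<Suc K] = [Suc i..<Suc j]"
    unfolding * by (simp del: upt_Suc)
  then show ?thesis
    by (simp add: trans_prob_def mat_prod_def step_factor_def[abs_def] del: upt_Suc)
qed

lemma trans_prob_within_bin:
  assumes "k \<in> {1..K}" "\<tau> (k - 1) \<le> s" "u < \<tau> k"
  shows "trans_prob \<tau> K \<alpha> s u = mat 1"
proof -
  have "\<not> (s < \<tau> i \<and> \<tau> i \<le> u)" if "i \<in> {1..K}" for i
  proof
    assume i: "s < \<tau> i \<and> \<tau> i \<le> u"
    then have "\<tau> (k - 1) < \<tau> i" "\<tau> i < \<tau> k" using assms by auto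
    then show False using that assms(1) by (auto simp: grid_less_iff)
  qed
  then have "filter (\<lambda>i. s < \<tau> i \<and> \<tau> i \<le> u) [1..<Suc K] = []"
    by (simp add: filter_empty_conv del: upt_Suc)
  then show ?thesis by (simp add: trans_prob_def del: upt_Suc)
qed

end

section \<open>The process on the grid\<close>

text \<open>The definite description in \<open>left_state\<close> is proper: two eventual values
  coincide, because the filter \<open>at_left t\<close> is not trivial.\<close>

lemma eventually_left_state:
  assumes "cadlag_path f" "0 < t"
  shows "eventually (\<lambda>u. f u = left_state f t) (at_left t)"
proof -
  obtain s where s: "eventually (\<lambda>u. f u = s) (at_left t)"
    using assms by (auto simp: cadlag_path_def)
  have "left_state f t = s"
    unfolding left_state_def
  proof (rule the_equality)
    show "eventually (\<lambda>u. f u = s) (at_left t)" by (rule s)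
    fix s' assume "eventually (\<lambda>u. f u = s') (at_left t)"
    with s have "eventually (\<lambda>u. s' = s) (at_left t)"
      by eventually_elim simp
    then show "s' = s" by simp
  qed
  then show ?thesis using s by simp
qed

text \<open>Starts at 0 and stays below \<open>t\<close>, so all sample times lie in the range in
  which the process is measurable.\<close>

definition approach :: "real \<Rightarrow> nat \<Rightarrow> real" where
  "approach t m = t - t / real (Suc m)"

lemma approach_nonneg: "0 < t \<Longrightarrow> 0 \<le> approach t m"
  by (simp add: approach_def field_simps)

lemma approach_at_left:
  assumes "0 < t"
  shows "filterlim (approach t) (at_left t) sequentially"
proof -
  have "(\<lambda>m. t - t * inverse (real (Suc m))) \<longlonglongrightarrow> t - t * 0"
    by (intro tendsto_intros LIMSEQ_inverse_real_of_nat)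
  then have "approach t \<longlonglongrightarrow> t"
    by (simp add: approach_def[abs_def] field_simps)
  then show ?thesis
    using assms by (auto simp: filterlim_at approach_def)
qed

text \<open>Since the path is eventually constant to the left of \<open>t\<close>, one sequence
  tending to \<open>t\<close> from below detects the constant. Countable quantifiers replace the
  limit, which gives measurability and almost sure statements.\<close>

lemma left_state_iff:
  assumes "cadlag_path f" "0 < t"
  shows "left_state f t = g \<longleftrightarrow> (\<exists>m. \<forall>n\<ge>m. f (approach t n) = g)"
proof -
  have *: "eventually (\<lambda>n. f (approach t n) = left_state f t) sequentially"
    using filterlim_iff[THEN iffD1, OF approach_at_left[OF assms(2)], rule_format,
      OF eventually_left_state[OF assms]] .
  show ?thesis
  proof
    assume "left_state f t = g"
    with * show "\<exists>m. \<forall>n\<ge>m. f (approach t n) = g"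
      by (simp add: eventually_sequentially)
  next
    assume "\<exists>m. \<forall>n\<ge>m. f (approach t n) = g"
    then have "eventually (\<lambda>n. f (approach t n) = g) sequentially"
      by (simp add: eventually_sequentially)
    with * have "eventually (\<lambda>n::nat. left_state f t = g) sequentially"
      by eventually_elim simp
    then show "left_state f t = g" by simp
  qed
qed

lemma measurable_left_state:
  fixes X :: "real \<Rightarrow> 'w \<Rightarrow> 's::finite"
  assumes X: "\<And>t. 0 \<le> t \<Longrightarrow> X t \<in> measurable N (count_space UNIV)"
    and cadlag: "\<And>\<omega>. \<omega> \<in> space N \<Longrightarrow> cadlag_path (\<lambda>t. X t \<omega>)"
    and t: "0 < t"
  shows "(\<lambda>\<omega>. left_state (\<lambda>u. X u \<omega>) t) \<in> measurable N (count_space UNIV)"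
proof (subst measurable_count_space_eq2, simp, intro conjI ballI)
  fix g :: 's
  have [measurable]: "X (approach t m) \<in> measurable N (count_space UNIV)" for m
    using X approach_nonneg[OF t] by blast
  have "(\<lambda>\<omega>. left_state (\<lambda>u. X u \<omega>) t) -` {g} \<inter> space N =
      {\<omega>\<in>space N. \<exists>m. \<forall>n\<ge>m. X (approach t n) \<omega> = g}"
    using left_state_iff[OF cadlag t] by auto
  also have "\<dots> \<in> sets N" by measurable
  finally show "(\<lambda>\<omega>. left_state (\<lambda>u. X u \<omega>) t) -` {g} \<inter> space N \<in> sets N" .
qed simp

section \<open>The Markov property at grid times\<close>

locale grid_markov_process = prob_space M + time_grid \<tau> K
  for M :: "'w measure" and \<tau> :: "nat \<Rightarrow> real" and K :: nat +
  fixes X :: "real \<Rightarrow> 'w \<Rightarrow> 's::finite" and \<alpha> :: "'s jumps"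
  assumes markov: "markov_process M X (trans_prob \<tau> K \<alpha>)"
begin

lemma X_measurable: "0 \<le> t \<Longrightarrow> X t \<in> measurable M (count_space UNIV)"
  using markov by (simp add: markov_process_def)

lemma X_grid_measurable [measurable]: "k \<le> K \<Longrightarrow> X (\<tau> k) \<in> measurable M (count_space UNIV)"
  by (simp add: X_measurable grid_nonneg)

lemma X_cadlag: "\<omega> \<in> space M \<Longrightarrow> cadlag_path (\<lambda>t. X t \<omega>)"
  using markov by (simp add: markov_process_def)

lemma left_state_measurable:
  "0 < t \<Longrightarrow> (\<lambda>\<omega>. left_state (\<lambda>u. X u \<omega>) t) \<in> measurable M (count_space UNIV)"
  by (intro measurable_left_state X_measurable X_cadlag)

text \<open>The product form of the Markov property does without the positivity condition: if the
  past has probability 0, both sides vanish.\<close>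

lemma markov_joint:
  assumes "0 \<le> s 0" "\<And>q. q < m \<Longrightarrow> s q < s (Suc q)" "s m < u" "\<And>q. q \<le> m \<Longrightarrow> 0 \<le> s q"
  shows "\<P>(\<omega> in M. (\<forall>q\<le>m. X (s q) \<omega> = y q) \<and> X u \<omega> = h) =
    \<P>(\<omega> in M. \<forall>q\<le>m. X (s q) \<omega> = y q) * trans_prob \<tau> K \<alpha> (s m) u $ y m $ h"
proof (cases "\<P>(\<omega> in M. \<forall>q\<le>m. X (s q) \<omega> = y q) = 0")
  case True
  have [measurable]: "X (s q) \<in> measurable M (count_space UNIV)" if "q \<le> m" for q
    using that assms by (intro X_measurable) auto
  have "\<P>(\<omega> in M. (\<forall>q\<le>m. X (s q) \<omega> = y q) \<and> X u \<omega> = h) \<le> \<P>(\<omega> in M. \<forall>q\<le>m. X (s q) \<omega> = y q)"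
    by (intro finite_measure_mono) auto
  with True have "\<P>(\<omega> in M. (\<forall>q\<le>m. X (s q) \<omega> = y q) \<and> X u \<omega> = h) = 0"
    by (simp add: measure_le_0_iff)
  with True show ?thesis by simp
next
  case False
  then have pos: "0 < \<P>(\<omega> in M. \<forall>q\<le>m. X (s q) \<omega> = y q)"
    by (simp add: zero_less_measure_iff)
  have "\<P>(\<omega> in M. X u \<omega> = h \<bar> \<forall>q\<le>m. X (s q) \<omega> = y q) = trans_prob \<tau> K \<alpha> (s m) u $ y m $ h"
    using markov pos assms(1-3) unfolding markov_process_def by blast
  then show ?thesis
    using pos by (simp add: cond_prob_def field_simps conj_commute)
qed

text \<open>For two different states at \<open>s\<close> and \<open>u\<close>, the joint probability
  contains an off-diagonal entry of the identity matrix and vanishes. There are only finitely many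
  such pairs.\<close>

lemma AE_constant_within_bin:
  assumes k: "k \<in> {1..K}" and su: "\<tau> (k - 1) \<le> s" "s < u" "u < \<tau> k"
  shows "AE \<omega> in M. X u \<omega> = X s \<omega>"
proof -
  have "k - 1 \<le> K" using k by auto
  with grid_nonneg[OF this] have s: "0 \<le> s" using su by linarith
  have "0 \<le> u" using s su by simp
  note [measurable] = X_measurable[OF s] X_measurable[OF this]
  have "AE \<omega> in M. \<not> (X s \<omega> = g \<and> X u \<omega> = h)" if "g \<noteq> h" for g h
  proof -
    \<comment> \<open>With \<open>m = 0\<close> the prescribed past is the state at the single time
      \<open>s\<close>.\<close>
    have "\<P>(\<omega> in M. X s \<omega> = g \<and> X u \<omega> = h) = 0"
      using markov_joint[of "\<lambda>_. s" 0 u "\<lambda>_. g" h] s su that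
      by (simp add: trans_prob_within_bin[OF k su(1,3)] mat_def)
    moreover have "{\<omega>\<in>space M. X s \<omega> = g \<and> X u \<omega> = h} \<in> events"
      using s su by measurable
    ultimately show ?thesis
      by (subst AE_iff_measurable[OF _ refl]) (auto simp: emeasure_eq_measure)
  qed
  then have "AE \<omega> in M. g \<noteq> h \<longrightarrow> \<not> (X s \<omega> = g \<and> X u \<omega> = h)" for g h
    by (cases "g = h") simp_all
  then have "AE \<omega> in M. \<forall>g h. g \<noteq> h \<longrightarrow> \<not> (X s \<omega> = g \<and> X u \<omega> = h)"
    by (simp only: AE_all_countable) simp
  then show ?thesis by eventually_elim metis
qed

text \<open>Constancy is needed only at the countably many times
  \<open>approach (\<tau> k) m\<close>, so the exceptional sets add up to a null set. From some
  index on, these times lie inside the bin.\<close>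

lemma AE_left_state:
  assumes k: "k \<in> {1..K}"
  shows "AE \<omega> in M. left_state (\<lambda>u. X u \<omega>) (\<tau> k) = X (\<tau> (k - 1)) \<omega>"
proof -
  have "AE \<omega> in M. \<tau> (k - 1) < approach (\<tau> k) m \<longrightarrow>
      X (approach (\<tau> k) m) \<omega> = X (\<tau> (k - 1)) \<omega>" for m
  proof (cases "\<tau> (k - 1) < approach (\<tau> k) m")
    case True
    then show ?thesis
      using AE_constant_within_bin[OF k order_refl, of "approach (\<tau> k) m"] grid_pos[OF k]
      by (simp add: approach_def)
  qed simp
  then have "AE \<omega> in M. \<forall>m. \<tau> (k - 1) < approach (\<tau> k) m \<longrightarrow>
      X (approach (\<tau> k) m) \<omega> = X (\<tau> (k - 1)) \<omega>"
    by (simp add: AE_all_countable)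
  then show ?thesis
  proof (rule AE_mp, intro AE_I2 impI)
    fix \<omega> assume \<omega>: "\<omega> \<in> space M" and
      *: "\<forall>m. \<tau> (k - 1) < approach (\<tau> k) m \<longrightarrow> X (approach (\<tau> k) m) \<omega> = X (\<tau> (k - 1)) \<omega>"
    have "eventually (\<lambda>u. \<tau> (k - 1) < u) (at_left (\<tau> k))"
      using eventually_at_left_real[OF grid_prev_less[OF k]] by eventually_elim simp
    then have "eventually (\<lambda>m. \<tau> (k - 1) < approach (\<tau> k) m) sequentially"
      using approach_at_left[OF grid_pos[OF k]] by (simp add: filterlim_iff)
    then have "eventually (\<lambda>m. X (approach (\<tau> k) m) \<omega> = X (\<tau> (k - 1)) \<omega>) sequentially"
      by eventually_elim (use * in blast)
    then show "left_state (\<lambda>u. X u \<omega>) (\<tau> k) = X (\<tau> (k - 1)) \<omega>"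
      using left_state_iff[OF X_cadlag[OF \<omega>] grid_pos[OF k]]
      by (simp add: eventually_sequentially)
  qed
qed

text \<open>The assumption on \<open>Q\<close> says that it depends only on the states up to index
  \<open>k\<close>. The event is thus a disjoint union of complete paths, and each of them
  contributes the same transition factor, since all end in \<open>u\<close>.\<close>

lemma prob_extend_path:
  assumes k: "k < K" and Q: "\<And>y y'. (\<And>q. q \<le> k \<Longrightarrow> y q = y' q) \<Longrightarrow> Q y \<Longrightarrow> Q y'"
  shows "\<P>(\<omega> in M. Q (\<lambda>q. X (\<tau> q) \<omega>) \<and> X (\<tau> k) \<omega> = u \<and> X (\<tau> (Suc k)) \<omega> = v) =
    \<P>(\<omega> in M. Q (\<lambda>q. X (\<tau> q) \<omega>) \<and> X (\<tau> k) \<omega> = u) * step_factor \<alpha> (Suc k) $ u $ v"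
proof -
  \<comment> \<open>Extensional functions on \<open>{..k}\<close> represent each path up to
    \<open>k\<close> exactly once, which makes the set finite and the union disjoint.\<close>
  define Y where "Y = {y \<in> {..k} \<rightarrow>\<^sub>E (UNIV::'s set). Q y \<and> y k = u}"
  have "finite Y" unfolding Y_def by (rule finite_subset[of _ "{..k} \<rightarrow>\<^sub>E UNIV"]) (auto intro: finite_PiE)
  \<comment> \<open>\<open>B = {v}\<close> gives the event with the next state prescribed, and
    \<open>B = UNIV\<close> the event without it.\<close>
  have split: "\<P>(\<omega> in M. Q (\<lambda>q. X (\<tau> q) \<omega>) \<and> X (\<tau> k) \<omega> = u \<and> X (\<tau> (Suc k)) \<omega> \<in> B) =
      (\<Sum>y\<in>Y. \<P>(\<omega> in M. (\<forall>q\<le>k. X (\<tau> q) \<omega> = y q) \<and> X (\<tau> (Suc k)) \<omega> \<in> B))" for B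
  proof -
    have "{\<omega>\<in>space M. Q (\<lambda>q. X (\<tau> q) \<omega>) \<and> X (\<tau> k) \<omega> = u \<and> X (\<tau> (Suc k)) \<omega> \<in> B} =
        (\<Union>y\<in>Y. {\<omega>\<in>space M. (\<forall>q\<le>k. X (\<tau> q) \<omega> = y q) \<and> X (\<tau> (Suc k)) \<omega> \<in> B})" (is "?L = ?R")
    proof (intro equalityI subsetI)
      fix \<omega> assume \<omega>: "\<omega> \<in> ?L"
      let ?y = "restrict (\<lambda>q. X (\<tau> q) \<omega>) {..k}"
      have "?y \<in> Y" unfolding Y_def using \<omega> Q[of "\<lambda>q. X (\<tau> q) \<omega>" ?y] by auto
      then show "\<omega> \<in> ?R" using \<omega> by (intro UN_I[of ?y]) auto
    next
      fix \<omega> assume "\<omega> \<in> ?R"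
      then obtain y where "y \<in> Y" "\<omega> \<in> space M" "\<forall>q\<le>k. X (\<tau> q) \<omega> = y q" "X (\<tau> (Suc k)) \<omega> \<in> B"
        by auto
      then show "\<omega> \<in> ?L" using Q[of y "\<lambda>q. X (\<tau> q) \<omega>"] by (auto simp: Y_def)
    qed
    moreover have "disjoint_family_on
        (\<lambda>y. {\<omega>\<in>space M. (\<forall>q\<le>k. X (\<tau> q) \<omega> = y q) \<and> X (\<tau> (Suc k)) \<omega> \<in> B}) Y"
    proof (unfold disjoint_family_on_def, intro ballI impI)
      fix y z assume yz: "y \<in> Y" "z \<in> Y" "y \<noteq> z"
      then obtain q where "q \<le> k" "y q \<noteq> z q"
        unfolding Y_def using PiE_ext[of y "{..k}" "\<lambda>_. UNIV" z] by auto
      then show "{\<omega>\<in>space M. (\<forall>q\<le>k. X (\<tau> q) \<omega> = y q) \<and> X (\<tau> (Suc k)) \<omega> \<in> B} \<inter>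
          {\<omega>\<in>space M. (\<forall>q\<le>k. X (\<tau> q) \<omega> = z q) \<and> X (\<tau> (Suc k)) \<omega> \<in> B} = {}"
        by auto
    qed
    moreover have "{\<omega>\<in>space M. (\<forall>q\<le>k. X (\<tau> q) \<omega> = y q) \<and> X (\<tau> (Suc k)) \<omega> \<in> B} \<in> events" for y
    proof -
      have [measurable]: "X (\<tau> q) \<in> measurable M (count_space UNIV)" if "q \<le> Suc k" for q
        using that k by (intro X_grid_measurable) simp
      show ?thesis by measurable
    qed
    ultimately show ?thesis
      by (subst finite_measure_finite_Union[OF \<open>finite Y\<close>, symmetric]) (auto simp only: image_subset_iff)
  qed
  have step: "\<P>(\<omega> in M. (\<forall>q\<le>k. X (\<tau> q) \<omega> = y q) \<and> X (\<tau> (Suc k)) \<omega> = v) =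
      \<P>(\<omega> in M. \<forall>q\<le>k. X (\<tau> q) \<omega> = y q) * step_factor \<alpha> (Suc k) $ y k $ v" for y
  proof -
    have "trans_prob \<tau> K \<alpha> (\<tau> k) (\<tau> (Suc k)) = step_factor \<alpha> (Suc k)"
      using trans_prob_grid[of k "Suc k" \<alpha>] k mat_prod_single[of "Suc k"] by simp
    then show ?thesis
      using markov_joint[of \<tau> k "\<tau> (Suc k)" y v] k
      by (simp add: grid_less_iff grid_nonneg)
  qed
  show ?thesis
    using split[of "{v}"] split[of UNIV] step
    by (simp add: sum_distrib_right Y_def)
qed

text \<open>For \<open>i = 0\<close>, truncated subtraction gives \<open>i - 1 = 0\<close>: \<open>c 0\<close> restricts the initial state.\<close>

definition constrained :: "(nat \<Rightarrow> 's \<Rightarrow> 's \<Rightarrow> bool) \<Rightarrow> nat \<Rightarrow> 'w \<Rightarrow> bool" where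
  "constrained c k \<omega> \<longleftrightarrow> (\<forall>i\<le>k. c i (X (\<tau> (i - 1)) \<omega>) (X (\<tau> i) \<omega>))"

definition constrained_factor :: "(nat \<Rightarrow> 's \<Rightarrow> 's \<Rightarrow> bool) \<Rightarrow> nat \<Rightarrow> real^'s^'s" where
  "constrained_factor c k = (\<chi> u v. of_bool (c k u v) * step_factor \<alpha> k $ u $ v)"

text \<open>The forward variable of the forward-backward algorithm for hidden Markov models, with
  the constraints up to \<open>k\<close> in the role of the observations.\<close>

definition forward_prob :: "(nat \<Rightarrow> 's \<Rightarrow> 's \<Rightarrow> bool) \<Rightarrow> nat \<Rightarrow> 's \<Rightarrow> real" where
  "forward_prob c k v = \<P>(\<omega> in M. constrained c k \<omega> \<and> X (\<tau> k) \<omega> = v)"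

lemma measurable_constrained [measurable]: "k \<le> K \<Longrightarrow> Measurable.pred M (constrained c k)"
proof -
  assume k: "k \<le> K"
  have *: "Measurable.pred M (\<lambda>\<omega>. c i (X (\<tau> (i - 1)) \<omega>) (X (\<tau> i) \<omega>))" if "i \<le> k" for i
  proof -
    have [measurable]: "X (\<tau> (i - 1)) \<in> measurable M (count_space UNIV)"
      "X (\<tau> i) \<in> measurable M (count_space UNIV)"
      using that k by (auto intro!: X_grid_measurable)
    show ?thesis by measurable
  qed
  then have "Measurable.pred M (\<lambda>\<omega>. \<forall>i\<in>{..k}. c i (X (\<tau> (i - 1)) \<omega>) (X (\<tau> i) \<omega>))"
    by (intro pred_intros_finite) auto
  then show ?thesis by (simp only: constrained_def[abs_def] Ball_def atMost_iff)
qed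

lemma constrained_cong:
  "(\<And>i. i \<le> k \<Longrightarrow> c i = d i) \<Longrightarrow> constrained c k \<omega> = constrained d k \<omega>"
  by (auto simp: constrained_def)

lemma prob_sum_states:
  assumes k: "k \<le> K" and Q: "Measurable.pred M Q"
  shows "\<P>(\<omega> in M. Q \<omega>) = (\<Sum>u\<in>UNIV. \<P>(\<omega> in M. Q \<omega> \<and> X (\<tau> k) \<omega> = u))"
proof -
  note [measurable] = X_grid_measurable[OF k] Q
  have "\<P>(\<omega> in M. Q \<omega>) = prob (\<Union>u\<in>UNIV. {\<omega>\<in>space M. Q \<omega> \<and> X (\<tau> k) \<omega> = u})"
    by (intro arg_cong[where f=prob]) auto
  also have "\<dots> = (\<Sum>u\<in>UNIV. \<P>(\<omega> in M. Q \<omega> \<and> X (\<tau> k) \<omega> = u))"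
    by (intro finite_measure_finite_Union) (auto simp: disjoint_family_on_def)
  finally show ?thesis .
qed

text \<open>Once the last two states are fixed to \<open>u\<close> and \<open>v\<close>, the
  constraint \<open>c (Suc k)\<close> is either true or makes the event empty. It therefore acts as
  a 0-1 weight on a single matrix entry.\<close>

lemma forward_prob_Suc:
  assumes k: "k < K"
  shows "forward_prob c (Suc k) v = (\<Sum>u\<in>UNIV. forward_prob c k u * constrained_factor c (Suc k) $ u $ v)"
proof -
  have kK: "k \<le> K" "Suc k \<le> K" using k by auto
  note [measurable] = X_grid_measurable[OF kK(1)] X_grid_measurable[OF kK(2)]
    measurable_constrained[OF kK(1)] measurable_constrained[OF kK(2)]
  have "forward_prob c (Suc k) v =
      (\<Sum>u\<in>UNIV. \<P>(\<omega> in M. (constrained c (Suc k) \<omega> \<and> X (\<tau> (Suc k)) \<omega> = v) \<and> X (\<tau> k) \<omega> = u))"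
    unfolding forward_prob_def by (intro prob_sum_states kK) measurable
  also have "\<dots> = (\<Sum>u\<in>UNIV. forward_prob c k u * constrained_factor c (Suc k) $ u $ v)"
  proof (intro sum.cong refl)
    fix u
    have Suc: "constrained c (Suc k) \<omega> \<longleftrightarrow>
        constrained c k \<omega> \<and> c (Suc k) (X (\<tau> k) \<omega>) (X (\<tau> (Suc k)) \<omega>)" for \<omega>
      by (auto simp: constrained_def le_Suc_eq)
    let ?Q = "\<lambda>y. \<forall>i\<le>k. c i (y (i - 1)) (y i)"
    have ext: "\<P>(\<omega> in M. constrained c k \<omega> \<and> X (\<tau> k) \<omega> = u \<and> X (\<tau> (Suc k)) \<omega> = v) =
        forward_prob c k u * step_factor \<alpha> (Suc k) $ u $ v"
      unfolding forward_prob_def constrained_def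
      by (rule prob_extend_path[OF k, of ?Q u v]) auto
    show "\<P>(\<omega> in M. (constrained c (Suc k) \<omega> \<and> X (\<tau> (Suc k)) \<omega> = v) \<and> X (\<tau> k) \<omega> = u) =
        forward_prob c k u * constrained_factor c (Suc k) $ u $ v"
    proof (cases "c (Suc k) u v")
      case True
      then have "{\<omega>\<in>space M. (constrained c (Suc k) \<omega> \<and> X (\<tau> (Suc k)) \<omega> = v) \<and> X (\<tau> k) \<omega> = u} =
          {\<omega>\<in>space M. constrained c k \<omega> \<and> X (\<tau> k) \<omega> = u \<and> X (\<tau> (Suc k)) \<omega> = v}"
        by (auto simp: Suc)
      with True ext show ?thesis by (simp add: constrained_factor_def)
    next
      case False
      then have "{\<omega>\<in>space M. (constrained c (Suc k) \<omega> \<and> X (\<tau> (Suc k)) \<omega> = v) \<and> X (\<tau> k) \<omega> = u} = {}"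
        by (auto simp: Suc)
      then have "\<P>(\<omega> in M. (constrained c (Suc k) \<omega> \<and> X (\<tau> (Suc k)) \<omega> = v) \<and> X (\<tau> k) \<omega> = u) = 0"
        by (simp only: measure_empty)
      with False show ?thesis by (simp add: constrained_factor_def)
    qed
  qed
  finally show ?thesis .
qed

lemma forward_prob_mat_prod:
  assumes "i \<le> j" "j \<le> K"
  shows "forward_prob c j v = (\<Sum>u\<in>UNIV. forward_prob c i u * mat_prod (constrained_factor c) i j $ u $ v)"
  using assms
proof (induction j arbitrary: v rule: dec_induct)
  case base
  show ?case by (simp add: mat_def if_distrib[of "\<lambda>x. _ * x"] cong: if_cong)
next
  case (step j)
  have "forward_prob c (Suc j) v = (\<Sum>w\<in>UNIV. \<Sum>u\<in>UNIV. forward_prob c i u *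
      mat_prod (constrained_factor c) i j $ u $ w * constrained_factor c (Suc j) $ w $ v)"
    using step by (simp add: forward_prob_Suc sum_distrib_right)
  also have "\<dots> = (\<Sum>u\<in>UNIV. forward_prob c i u * mat_prod (constrained_factor c) i (Suc j) $ u $ v)"
    using step.hyps(1)
    by (subst sum.swap) (simp add: mat_prod_Suc matrix_matrix_mult_def sum_distrib_left mult.assoc)
  finally show ?case .
qed

text \<open>The constraints at \<open>p\<close> and \<open>q\<close> pin the states there, so the
  sums over these two states have one nonzero term each. The probability becomes past times bridge
  times future.\<close>

lemma prob_constrained_bridge:
  assumes pq: "p < q" "q \<le> K"
    and cp: "\<And>u v. c p u v \<Longrightarrow> v = a" and cq: "\<And>u v. c q u v \<Longrightarrow> v = b"
  shows "\<P>(\<omega> in M. constrained c K \<omega>) = forward_prob c p a *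
    mat_prod (constrained_factor c) p q $ a $ b * (\<Sum>w\<in>UNIV. mat_prod (constrained_factor c) q K $ b $ w)"
proof -
  have fp: "forward_prob c p u = 0" if "u \<noteq> a" for u
  proof -
    have "{\<omega>\<in>space M. constrained c p \<omega> \<and> X (\<tau> p) \<omega> = u} = {}"
      using cp that by (fastforce simp: constrained_def)
    then show ?thesis unfolding forward_prob_def by (simp only: measure_empty)
  qed
  have fq: "forward_prob c q v = 0" if "v \<noteq> b" for v
  proof -
    have "{\<omega>\<in>space M. constrained c q \<omega> \<and> X (\<tau> q) \<omega> = v} = {}"
      using cq that by (fastforce simp: constrained_def)
    then show ?thesis unfolding forward_prob_def by (simp only: measure_empty)
  qed
  have "\<P>(\<omega> in M. constrained c K \<omega>) = (\<Sum>w\<in>UNIV. forward_prob c K w)"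
    unfolding forward_prob_def by (intro prob_sum_states measurable_constrained order_refl)
  also have "\<dots> = (\<Sum>w\<in>UNIV. forward_prob c q b * mat_prod (constrained_factor c) q K $ b $ w)"
    by (simp only: forward_prob_mat_prod[OF pq(2) order_refl] sum_supported_at[OF fq])
  also have "forward_prob c q b = forward_prob c p a * mat_prod (constrained_factor c) p q $ a $ b"
    by (simp only: forward_prob_mat_prod[OF less_imp_le[OF pq(1)] pq(2)] sum_supported_at[OF fp])
  finally show ?thesis by (simp add: sum_distrib_left)
qed

text \<open>The factors for the past of \<open>p\<close> and the future of \<open>q\<close> cancel, because \<open>c\<close> and \<open>d\<close> fix the
  states at both ends.\<close>

lemma prob_constrained_ratio:
  assumes pq: "p < q" "q \<le> K"
    and cp: "\<And>u v. c p u v \<Longrightarrow> v = a" and cq: "\<And>u v. c q u v \<Longrightarrow> v = b"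
    and dq: "\<And>u v. d q u v \<Longrightarrow> v = b"
    and cd: "\<And>i. i \<le> p \<or> q < i \<Longrightarrow> d i = c i"
    and pos: "\<P>(\<omega> in M. constrained c K \<omega>) \<noteq> 0"
  shows "\<P>(\<omega> in M. constrained d K \<omega>) / \<P>(\<omega> in M. constrained c K \<omega>) =
    mat_prod (constrained_factor d) p q $ a $ b / mat_prod (constrained_factor c) p q $ a $ b"
proof -
  have "forward_prob d p a = forward_prob c p a"
    using cd constrained_cong[of p d c] by (simp add: forward_prob_def)
  moreover have "mat_prod (constrained_factor d) q K = mat_prod (constrained_factor c) q K"
    using cd by (intro mat_prod_cong) (simp add: constrained_factor_def)
  moreover have "\<And>u v. d p u v \<Longrightarrow> v = a" using cd cp by simp
  \<comment> \<open>By \<open>pos\<close>, the common factors for past and future are nonzero and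
    may be cancelled.\<close>
  ultimately show ?thesis
    using pos prob_constrained_bridge[OF pq, of c a b] prob_constrained_bridge[OF pq, of d a b] cp cq dq
    by (auto simp: field_simps)
qed

end

section \<open>Observations of one subject\<close>

locale observed_subject = grid_markov_process M \<tau> K X \<alpha>
  for M :: "'w measure" and \<tau> K and X :: "real \<Rightarrow> 'w \<Rightarrow> 's::finite" and \<alpha> +
  fixes V :: "('s \<times> 's) set" and E :: "'s set" and W :: "nat \<Rightarrow> 'w \<Rightarrow> ereal"
    and N :: nat and t :: "nat \<Rightarrow> real" and x :: "nat \<Rightarrow> 's"
  assumes acyclic: "acyclic V"
    and visit_less_Suc: "\<And>j. j < N \<Longrightarrow> t j < t (Suc j)"
    and visit_on_grid: "\<And>j. j \<le> N \<Longrightarrow> t j \<in> \<tau> ` {0..K}"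
    and visits: "cond_indep_visits M V E X W N t x"
begin

section \<open>Path part and schedule part of an observation\<close>

lemma visit_nonneg: "j \<le> N \<Longrightarrow> 0 \<le> t j"
  using visit_on_grid[of j] grid_nonneg by auto

lemma W_measurable: "j \<le> Suc N \<Longrightarrow> W j \<in> borel_measurable M"
  using visits by (simp add: cond_indep_visits_def)

text \<open>The condition that \<open>obs_event\<close> puts on \<open>W j\<close>. It is separated
  from the condition on the path, because conditional independence treats the two parts
  differently.\<close>

definition scheduled :: "nat \<Rightarrow> ereal set" where
  "scheduled j = (if x j \<in> E \<and> 0 < t j then {ereal (t j)..} else {ereal (t j)})"

definition path_event :: "nat \<Rightarrow> 'w \<Rightarrow> bool" where
  "path_event j \<omega> \<longleftrightarrow> X (t j) \<omega> = x j \<and>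
     (x j \<in> E \<and> 0 < t j \<longrightarrow> left_state (\<lambda>u. X u \<omega>) (t j) \<in> reach V (x j))"

definition path_history :: "nat \<Rightarrow> 'w set" where
  "path_history m = {\<omega>\<in>space M. \<forall>j<m. path_event j \<omega>}"

abbreviation history :: "nat \<Rightarrow> 'w set" where
  "history m \<equiv> obs_history M V E X W t x m"

abbreviation observed :: "'w set" where
  "observed \<equiv> obs_subject M V E X W N t x"

lemma obs_event_iff: "obs_event V E X W t x j \<omega> \<longleftrightarrow> path_event j \<omega> \<and> W j \<omega> \<in> scheduled j"
  by (auto simp: obs_event_def path_event_def scheduled_def)

lemma scheduled_borel [measurable]: "scheduled j \<in> sets borel"
  by (simp add: scheduled_def)

text \<open>The events generated by the process, packaged as a measure so that the rules for
  measurable functions and predicates apply to them.\<close>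

definition process_algebra :: "'w measure" where
  "process_algebra = sigma (space M) {{\<omega>\<in>space M. X u \<omega> = h} | u h. 0 \<le> u}"

definition subject_algebra :: "'w measure" where
  "subject_algebra = sigma (space M)
     ({{\<omega>\<in>space M. X u \<omega> = h} | u h. 0 \<le> u} \<union>
      {W j -` B \<inter> space M | j B. j \<le> Suc N \<and> B \<in> sets borel})"

lemma space_algebras [simp]: "space process_algebra = space M" "space subject_algebra = space M"
  by (simp_all add: process_algebra_def subject_algebra_def space_measure_of_conv)

lemma sets_process_algebra: "sets process_algebra = process_events M X"
  unfolding process_algebra_def process_events_def by (rule sets_measure_of) auto

lemma sets_subject_algebra: "sets subject_algebra = subject_events M X W N"
  unfolding subject_algebra_def subject_events_def by (rule sets_measure_of) auto

lemma X_measurable_algebraI: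
  assumes "space A = space M" "\<And>h. {\<omega>\<in>space M. X u \<omega> = h} \<in> sets A"
  shows "X u \<in> measurable A (count_space UNIV)"
proof (subst measurable_count_space_eq2, simp, intro conjI ballI)
  fix h
  have "X u -` {h} \<inter> space A = {\<omega>\<in>space M. X u \<omega> = h}" using assms(1) by auto
  then show "X u -` {h} \<inter> space A \<in> sets A" using assms(2) by simp
qed simp

lemma X_measurable_process_algebra: "0 \<le> u \<Longrightarrow> X u \<in> measurable process_algebra (count_space UNIV)"
  by (rule X_measurable_algebraI)
    (auto simp: sets_process_algebra process_events_def intro!: sigma_sets.Basic)

lemma X_measurable_subject_algebra: "0 \<le> u \<Longrightarrow> X u \<in> measurable subject_algebra (count_space UNIV)"
  by (rule X_measurable_algebraI)
    (auto simp: sets_subject_algebra subject_events_def intro!: sigma_sets.Basic)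

lemma W_measurable_subject_algebra:
  assumes "j \<le> Suc N" shows "W j \<in> borel_measurable subject_algebra"
proof (rule measurableI)
  fix B :: "ereal set" assume "B \<in> sets borel"
  then show "W j -` B \<inter> space subject_algebra \<in> sets subject_algebra"
    using assms by (auto simp: sets_subject_algebra subject_events_def intro!: sigma_sets.Basic)
qed simp

lemma process_events_subset: "process_events M X \<subseteq> events"
  unfolding process_events_def
proof (rule sets.sigma_sets_subset, safe)
  fix u :: real and h assume "0 \<le> u"
  note [measurable] = X_measurable[OF this]
  show "{\<omega>\<in>space M. X u \<omega> = h} \<in> events" by measurable
qed

text \<open>Kept general in \<open>A\<close>, because membership is needed in the events of
  \<open>M\<close>, in the process events and in the events of the subject.\<close>

lemma path_history_sets:
  assumes X: "\<And>u. 0 \<le> u \<Longrightarrow> X u \<in> measurable A (count_space UNIV)"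
    and A: "space A = space M" and m: "m \<le> Suc N"
  shows "path_history m \<in> sets A"
proof -
  have "Measurable.pred A (path_event j)" if "j < m" for j
  proof -
    have j: "0 \<le> t j" using visit_nonneg[of j] that m by simp
    note [measurable] = X[OF j]
    have "(\<lambda>\<omega>. left_state (\<lambda>u. X u \<omega>) (t j)) \<in> measurable A (count_space UNIV)" if "0 < t j"
      using that by (intro measurable_left_state X X_cadlag) (auto simp: A)
    then show ?thesis
      unfolding path_event_def[abs_def] by (cases "0 < t j") (simp_all, measurable)
  qed
  then have "Measurable.pred A (\<lambda>\<omega>. \<forall>j\<in>{..<m}. path_event j \<omega>)"
    by (intro pred_intros_finite) auto
  then show ?thesis
    by (simp only: path_history_def pred_def A[symmetric] Ball_def lessThan_iff)
qed

lemma path_history_process_events: "m \<le> Suc N \<Longrightarrow> path_history m \<in> process_events M X"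
  using path_history_sets[of process_algebra] X_measurable_process_algebra
  by (simp add: sets_process_algebra)

lemma obs_history_sets:
  assumes X: "\<And>u. 0 \<le> u \<Longrightarrow> X u \<in> measurable A (count_space UNIV)"
    and W: "\<And>j. j \<le> Suc N \<Longrightarrow> W j \<in> borel_measurable A"
    and A: "space A = space M" and m: "m \<le> Suc N"
  shows "history m \<in> sets A"
proof -
  have "Measurable.pred A (\<lambda>\<omega>. W j \<omega> \<in> scheduled j)" if "j < m" for j
  proof -
    have [measurable]: "W j \<in> borel_measurable A" using that m by (intro W) simp
    show ?thesis by measurable
  qed
  then have "Measurable.pred A (\<lambda>\<omega>. \<forall>j\<in>{..<m}. W j \<omega> \<in> scheduled j)"
    by (intro pred_intros_finite) auto
  then have "{\<omega>\<in>space M. \<forall>j\<in>{..<m}. W j \<omega> \<in> scheduled j} \<in> sets A"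
    by (simp only: pred_def A)
  then have "path_history m \<inter> {\<omega>\<in>space M. \<forall>j\<in>{..<m}. W j \<omega> \<in> scheduled j} \<in> sets A"
    using path_history_sets[OF X A m] by (rule sets.Int[rotated])
  also have "path_history m \<inter> {\<omega>\<in>space M. \<forall>j\<in>{..<m}. W j \<omega> \<in> scheduled j} = history m"
    by (auto simp: path_history_def obs_history_def obs_event_iff)
  finally show ?thesis .
qed

section \<open>Elimination of the visit times\<close>

lemma observed_eq: "observed = history (Suc N) \<inter> (W (Suc N) -` {\<infinity>} \<inter> space M)"
  by (auto simp: obs_subject_def obs_history_def)

lemma observed_subject_events: "observed \<in> subject_events M X W N"
proof -
  have "history (Suc N) \<in> sets subject_algebra"
    by (intro obs_history_sets X_measurable_subject_algebra W_measurable_subject_algebra) auto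
  moreover have "W (Suc N) -` {\<infinity>} \<inter> space subject_algebra \<in> sets subject_algebra"
    by (intro measurable_sets[OF W_measurable_subject_algebra]) auto
  ultimately show ?thesis
    by (auto simp: observed_eq sets_subject_algebra[symmetric])
qed

text \<open>Under the conditional law given the history, \<open>w\<close> is the probability that
  \<open>W j\<close> lies in \<open>B\<close>; by independence it does not depend on
  \<open>A\<close>. If the history is a null event, both sides vanish and \<open>w = 0\<close>
  serves.\<close>

lemma visit_independent:
  assumes j: "j \<le> Suc N" and B: "B \<in> sets borel"
  obtains w where "\<And>A. A \<in> process_events M X \<Longrightarrow>
    prob (A \<inter> (history j \<inter> (W j -` B \<inter> space M))) = w * prob (A \<inter> history j)"
proof (cases "0 < prob (history j)")
  case True
  let ?U = "uniform_measure M (history j)"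
  have H: "emeasure M (history j) \<noteq> 0" "emeasure M (history j) \<noteq> \<infinity>"
    using True by (auto simp: emeasure_eq_measure)
  interpret U: prob_space ?U by (rule prob_space_uniform_measure[OF H])
  have indep: "U.indep_set {W j -` B \<inter> space M | B. B \<in> sets borel} (process_events M X)"
    using visits j True by (simp add: cond_indep_visits_def Let_def)
  have WB: "W j -` B \<inter> space M \<in> events" using measurable_sets[OF W_measurable[OF j] B] .
  show ?thesis
  proof (rule that)
    fix A assume A: "A \<in> process_events M X"
    then have Ae: "A \<in> events" using process_events_subset by auto
    have "U.prob ((W j -` B \<inter> space M) \<inter> A) = U.prob (W j -` B \<inter> space M) * U.prob A"
      using indep A B by (intro U.indep_setD) auto
    then have "prob (history j \<inter> ((W j -` B \<inter> space M) \<inter> A)) =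
        U.prob (W j -` B \<inter> space M) * prob (history j \<inter> A)"
      using True Ae WB by (simp add: measure_uniform_measure[OF H] field_simps)
    then show "prob (A \<inter> (history j \<inter> (W j -` B \<inter> space M))) =
        U.prob (W j -` B \<inter> space M) * prob (A \<inter> history j)"
      by (simp add: Int_ac)
  qed
next
  case False
  then have zero: "prob (history j) = 0"
    by (simp add: zero_less_measure_iff)
  have He: "history j \<in> events"
    using j by (intro obs_history_sets X_measurable W_measurable) auto
  show ?thesis
  proof (rule that)
    fix A assume A: "A \<in> process_events M X"
    have "prob (A \<inter> (history j \<inter> (W j -` B \<inter> space M))) = 0"
      using finite_measure_mono[OF _ He, of "A \<inter> (history j \<inter> (W j -` B \<inter> space M))"] zero
      by (auto simp: measure_le_0_iff)
    then show "prob (A \<inter> (history j \<inter> (W j -` B \<inter> space M))) = 0 * prob (A \<inter> history j)"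
      by simp
  qed
qed

text \<open>One constant works for all process events \<open>A\<close>, so it will cancel in
  conditional probabilities. It is the product of the conditional probabilities of the successive
  schedules.\<close>

lemma prob_history_proportional:
  assumes "m \<le> Suc N"
  shows "\<exists>c. \<forall>A\<in>process_events M X. prob (A \<inter> history m) = c * prob (A \<inter> path_history m)"
  using assms
proof (induction m)
  case 0
  show ?case by (rule exI[of _ 1]) (simp add: obs_history_def path_history_def)
next
  case (Suc m)
  then obtain c where c: "\<And>A. A \<in> process_events M X \<Longrightarrow>
      prob (A \<inter> history m) = c * prob (A \<inter> path_history m)"
    by auto
  obtain w where w: "\<And>A. A \<in> process_events M X \<Longrightarrow>
      prob (A \<inter> (history m \<inter> (W m -` scheduled m \<inter> space M))) = w * prob (A \<inter> history m)"
    using visit_independent[of m "scheduled m"] Suc.prems by auto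
  show ?case
  proof (intro exI ballI)
    fix A assume A: "A \<in> process_events M X"
    have path: "A \<inter> path_history (Suc m) \<in> process_events M X"
      using A path_history_process_events[OF Suc.prems] by (simp add: sets_process_algebra[symmetric])
    \<comment> \<open>The path part of observation \<open>m\<close> is a process event and is
      absorbed into \<open>A\<close>. Only the schedule \<open>W m\<close> is left to split off
      given the earlier history.\<close>
    have "A \<inter> history (Suc m) =
        (A \<inter> path_history (Suc m)) \<inter> (history m \<inter> (W m -` scheduled m \<inter> space M))"
      by (auto simp: obs_history_def path_history_def obs_event_iff less_Suc_eq)
    then have "prob (A \<inter> history (Suc m)) = w * prob ((A \<inter> path_history (Suc m)) \<inter> history m)"
      using w[OF path] by simp
    also have "\<dots> = w * (c * prob ((A \<inter> path_history (Suc m)) \<inter> path_history m))"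
      using c[OF path] by simp
    also have "(A \<inter> path_history (Suc m)) \<inter> path_history m = A \<inter> path_history (Suc m)"
      by (auto simp: path_history_def)
    finally show "prob (A \<inter> history (Suc m)) = (w * c) * prob (A \<inter> path_history (Suc m))"
      by simp
  qed
qed

text \<open>The factor \<open>w * c\<close>, which includes the end of follow-up, is the same for
  \<open>A\<close> and for the whole space. Positive probability of the data makes it nonzero, so it
  cancels.\<close>

lemma cond_prob_observed:
  assumes A: "A \<in> process_events M X" and pos: "0 < prob observed"
  shows "prob (A \<inter> observed) / prob observed =
      prob (A \<inter> path_history (Suc N)) / prob (path_history (Suc N))"
    and "0 < prob (path_history (Suc N))"
proof -
  obtain c where c: "\<And>A. A \<in> process_events M X \<Longrightarrow>
      prob (A \<inter> history (Suc N)) = c * prob (A \<inter> path_history (Suc N))"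
    using prob_history_proportional[of "Suc N"] by auto
  obtain w where w: "\<And>A. A \<in> process_events M X \<Longrightarrow>
      prob (A \<inter> observed) = w * prob (A \<inter> history (Suc N))"
    using visit_independent[of "Suc N" "{\<infinity>}"] by (auto simp: observed_eq)
  have obs: "prob (A \<inter> observed) = w * c * prob (A \<inter> path_history (Suc N))"
    if "A \<in> process_events M X" for A
    using w[OF that] c[OF that] by simp
  have "space M \<in> process_events M X"
    using sets.top[of process_algebra] by (simp add: sets_process_algebra)
  from obs[OF this] have tot: "prob observed = w * c * prob (path_history (Suc N))"
    by (simp add: path_history_def observed_eq obs_history_def Int_def conj_ac cong: conj_cong)
  with pos have "w * c \<noteq> 0" "prob (path_history (Suc N)) \<noteq> 0" by auto
  then show "prob (A \<inter> observed) / prob observed =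
      prob (A \<inter> path_history (Suc N)) / prob (path_history (Suc N))"
    "0 < prob (path_history (Suc N))"
    using obs[OF A] tot by (auto simp: zero_less_measure_iff)
qed

section \<open>Visits as constraints on the chain\<close>

lemma visit_less: "i < j \<Longrightarrow> j \<le> N \<Longrightarrow> t i < t j"
proof (induction j)
  case (Suc j)
  show ?case
  proof (cases "i = j")
    case True
    then show ?thesis using visit_less_Suc[of j] Suc.prems by simp
  next
    case False
    then have "t i < t j" using Suc by simp
    also have "t j < t (Suc j)" using visit_less_Suc[of j] Suc.prems by simp
    finally show ?thesis .
  qed
qed simp

lemma visit_le: "i \<le> j \<Longrightarrow> j \<le> N \<Longrightarrow> t i \<le> t j"
  using visit_less[of i j] by (cases "i = j") auto

lemma visit_eq_iff: "i \<le> N \<Longrightarrow> j \<le> N \<Longrightarrow> t i = t j \<longleftrightarrow> i = j"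
  using visit_less[of i j] visit_less[of j i] by (cases i j rule: linorder_cases) auto

text \<open>Here \<open>u\<close> is the state at the previous grid time, which almost surely equals
  the left limit at \<open>\<tau> k\<close>. The constraint is vacuous at grid times without a visit
  of this subject, and at time 0 it demands no transition.\<close>

definition visit_constraint :: "nat \<Rightarrow> 's \<Rightarrow> 's \<Rightarrow> bool" where
  "visit_constraint k u v \<longleftrightarrow> (\<forall>j\<le>N. t j = \<tau> k \<longrightarrow> v = x j \<and> (x j \<in> E \<and> 0 < \<tau> k \<longrightarrow> u \<in> reach V (x j)))"

lemma AE_left_states:
  "AE \<omega> in M. \<forall>k\<in>{1..K}. left_state (\<lambda>u. X u \<omega>) (\<tau> k) = X (\<tau> (k - 1)) \<omega>"
  by (intro AE_finite_allI AE_left_state) auto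

lemma path_history_iff:
  assumes left: "\<forall>k\<in>{1..K}. left_state (\<lambda>u. X u \<omega>) (\<tau> k) = X (\<tau> (k - 1)) \<omega>" and "\<omega> \<in> space M"
  shows "\<omega> \<in> path_history (Suc N) \<longleftrightarrow> constrained visit_constraint K \<omega>"
proof
  assume \<omega>: "\<omega> \<in> path_history (Suc N)"
  show "constrained visit_constraint K \<omega>"
    unfolding constrained_def visit_constraint_def
  proof (intro allI impI conjI)
    fix k j assume k: "k \<le> K" and j: "j \<le> N" "t j = \<tau> k"
    then have pe: "path_event j \<omega>" using \<omega> by (auto simp: path_history_def)
    then show "X (\<tau> k) \<omega> = x j" using j by (simp add: path_event_def)
    assume "x j \<in> E \<and> 0 < \<tau> k"
    \<comment> \<open>A positive grid time has index at least 1, so the assumption on left states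
      covers it.\<close>
    moreover from this have "k \<noteq> 0" using grid_start by (cases k) auto
    ultimately show "X (\<tau> (k - 1)) \<omega> \<in> reach V (x j)"
      using pe j k left by (auto simp: path_event_def)
  qed
next
  assume c: "constrained visit_constraint K \<omega>"
  have "path_event j \<omega>" if j: "j \<le> N" for j
  proof -
    obtain k where k: "k \<le> K" "t j = \<tau> k" using visit_on_grid[OF j] by auto
    have v: "X (\<tau> k) \<omega> = x j" "x j \<in> E \<Longrightarrow> 0 < \<tau> k \<Longrightarrow> X (\<tau> (k - 1)) \<omega> \<in> reach V (x j)"
      using c k j unfolding constrained_def visit_constraint_def by blast+
    have "k \<noteq> 0" if "0 < \<tau> k" using that grid_start by (cases k) auto
    then show ?thesis using v k left by (auto simp: path_event_def)
  qed
  then show "\<omega> \<in> path_history (Suc N)" using assms(2) by (simp add: path_history_def)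
qed

text \<open>The relation \<open>e\<close> on the states before and at \<open>\<tau> k\<close> covers
  a transition and a state at risk alike.\<close>

definition refined_constraint :: "nat \<Rightarrow> ('s \<Rightarrow> 's \<Rightarrow> bool) \<Rightarrow> nat \<Rightarrow> 's \<Rightarrow> 's \<Rightarrow> bool" where
  "refined_constraint k e i u v \<longleftrightarrow> visit_constraint i u v \<and> (i = k \<longrightarrow> e u v)"

lemma bin_event_process_events:
  assumes "k \<in> {1..K}"
  shows "{\<omega>\<in>space M. e (left_state (\<lambda>u. X u \<omega>) (\<tau> k)) (X (\<tau> k) \<omega>)} \<in> process_events M X"
proof -
  have [measurable]: "X (\<tau> k) \<in> measurable process_algebra (count_space UNIV)"
    using assms by (intro X_measurable_process_algebra grid_nonneg) simp
  have [measurable]: "(\<lambda>\<omega>. left_state (\<lambda>u. X u \<omega>) (\<tau> k)) \<in> measurable process_algebra (count_space UNIV)"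
    by (intro measurable_left_state X_measurable_process_algebra X_cadlag grid_pos assms) auto
  have "{\<omega>\<in>space process_algebra. e (left_state (\<lambda>u. X u \<omega>) (\<tau> k)) (X (\<tau> k) \<omega>)} \<in> sets process_algebra"
    by measurable
  then show ?thesis by (simp add: sets_process_algebra)
qed

lemma prob_path_history: "prob (path_history (Suc N)) = \<P>(\<omega> in M. constrained visit_constraint K \<omega>)"
proof (rule measure_eq_AE)
  show "AE \<omega> in M. \<omega> \<in> path_history (Suc N) \<longleftrightarrow> \<omega> \<in> {\<omega>\<in>space M. constrained visit_constraint K \<omega>}"
    using AE_left_states by (rule AE_mp) (auto simp: path_history_iff intro!: AE_I2)
  show "path_history (Suc N) \<in> events"
    using path_history_process_events process_events_subset by auto
  show "{\<omega>\<in>space M. constrained visit_constraint K \<omega>} \<in> events"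
    using measurable_constrained[OF order_refl] by (simp add: pred_def)
qed

lemma prob_bin_event:
  assumes k: "k \<in> {1..K}"
  shows "prob ({\<omega>\<in>space M. e (left_state (\<lambda>u. X u \<omega>) (\<tau> k)) (X (\<tau> k) \<omega>)} \<inter> path_history (Suc N)) =
    \<P>(\<omega> in M. constrained (refined_constraint k e) K \<omega>)"
proof (rule measure_eq_AE)
  have refined: "constrained (refined_constraint k e) K \<omega> \<longleftrightarrow>
      constrained visit_constraint K \<omega> \<and> e (X (\<tau> (k - 1)) \<omega>) (X (\<tau> k) \<omega>)" for \<omega>
    using k by (auto simp: constrained_def refined_constraint_def)
  from AE_left_states show "AE \<omega> in M.
      \<omega> \<in> {\<omega>\<in>space M. e (left_state (\<lambda>u. X u \<omega>) (\<tau> k)) (X (\<tau> k) \<omega>)} \<inter> path_history (Suc N) \<longleftrightarrow>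
      \<omega> \<in> {\<omega>\<in>space M. constrained (refined_constraint k e) K \<omega>}"
  proof (rule AE_mp, intro AE_I2 impI)
    fix \<omega> assume \<omega>: "\<omega> \<in> space M"
      and left: "\<forall>k\<in>{1..K}. left_state (\<lambda>u. X u \<omega>) (\<tau> k) = X (\<tau> (k - 1)) \<omega>"
    then show "\<omega> \<in> {\<omega>\<in>space M. e (left_state (\<lambda>u. X u \<omega>) (\<tau> k)) (X (\<tau> k) \<omega>)} \<inter> path_history (Suc N) \<longleftrightarrow>
      \<omega> \<in> {\<omega>\<in>space M. constrained (refined_constraint k e) K \<omega>}"
      using path_history_iff[OF left \<omega>] bspec[OF left k] refined[of \<omega>] by auto
  qed
  show "{\<omega>\<in>space M. e (left_state (\<lambda>u. X u \<omega>) (\<tau> k)) (X (\<tau> k) \<omega>)} \<inter> path_history (Suc N) \<in> events"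
    using bin_event_process_events[OF k] path_history_process_events process_events_subset by auto
  show "{\<omega>\<in>space M. constrained (refined_constraint k e) K \<omega>} \<in> events"
    using measurable_constrained[OF order_refl] by (simp add: pred_def)
qed

lemma cond_prob_bin_event:
  assumes k: "k \<in> {1..K}" and pos: "0 < prob observed"
  shows "prob ({\<omega>\<in>space M. e (left_state (\<lambda>u. X u \<omega>) (\<tau> k)) (X (\<tau> k) \<omega>)} \<inter> observed) / prob observed =
      \<P>(\<omega> in M. constrained (refined_constraint k e) K \<omega>) / \<P>(\<omega> in M. constrained visit_constraint K \<omega>)"
    and "\<P>(\<omega> in M. constrained visit_constraint K \<omega>) \<noteq> 0"
  using cond_prob_observed(1)[OF bin_event_process_events[OF k, of e] pos]
    cond_prob_observed(2)[OF bin_event_process_events[OF k, of e] pos]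
  by (simp_all add: prob_bin_event[OF k] prob_path_history)

section \<open>Ends of the observational interval\<close>

lemma left_end_eq:
  assumes j: "j < N" "t j \<le> \<tau> (k - 1)" "\<tau> k \<le> t (Suc j)" and k: "k \<in> {1..K}"
  shows "left_end \<tau> N t k = t j"
  unfolding left_end_def
proof (rule Max_eqI)
  show "finite {t j |j. j \<le> N \<and> t j \<le> \<tau> (k - 1)}" by simp
  show "t j \<in> {t j |j. j \<le> N \<and> t j \<le> \<tau> (k - 1)}" using j by auto
  fix y assume "y \<in> {t j |j. j \<le> N \<and> t j \<le> \<tau> (k - 1)}"
  then obtain i where i: "y = t i" "i \<le> N" "t i \<le> \<tau> (k - 1)" by auto
  have "i \<le> j"
    using i j visit_le[of "Suc j" i] grid_prev_less[OF k] by (cases "i \<le> j") auto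
  then show "y \<le> t j" using visit_le[of i j] i j by simp
qed

lemma right_end_eq:
  assumes j: "j < N" "t j \<le> \<tau> (k - 1)" "\<tau> k \<le> t (Suc j)" and k: "k \<in> {1..K}"
  shows "right_end \<tau> N t k = t (Suc j)"
  unfolding right_end_def
proof (rule Min_eqI)
  show "finite {t j |j. j \<le> N \<and> \<tau> k \<le> t j}" by simp
  show "t (Suc j) \<in> {t j |j. j \<le> N \<and> \<tau> k \<le> t j}" using j by auto
  fix y assume "y \<in> {t j |j. j \<le> N \<and> \<tau> k \<le> t j}"
  then obtain i where i: "y = t i" "i \<le> N" "\<tau> k \<le> t i" by auto
  have "Suc j \<le> i"
    using i j visit_le[of i j] grid_prev_less[OF k] by (cases "i \<le> j") auto
  then show "t (Suc j) \<le> y" using visit_le[of "Suc j" i] i by simp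
qed

lemma state_at_visit: "j \<le> N \<Longrightarrow> state_at N t x (t j) = x j"
  unfolding state_at_def by (rule arg_cong[where f=x], rule the_equality) (auto simp: visit_eq_iff)

text \<open>The first visit not before \<open>\<tau> k\<close> ends the interval. It has a
  predecessor because visit 0 is no later than \<open>\<tau> (k - 1)\<close>. The predecessor comes
  before \<open>\<tau> k\<close> and lies on the grid, hence is no later than
  \<open>\<tau> (k - 1)\<close>.\<close>

lemma obs_interval:
  assumes k: "k \<in> {1..K}" and "t 0 \<le> \<tau> (k - 1)" "\<tau> k \<le> t N"
  obtains j p q where "j < N" "t j = \<tau> p" "t (Suc j) = \<tau> q" "p < k" "k \<le> q" "q \<le> K"
    "left_end \<tau> N t k = \<tau> p" "right_end \<tau> N t k = \<tau> q"
    "state_at N t x (\<tau> p) = x j" "state_at N t x (\<tau> q) = x (Suc j)" "grid_index \<tau> K (\<tau> q) = q"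
proof -
  define i where "i = (LEAST i. \<tau> k \<le> t i)"
  have i: "\<tau> k \<le> t i" "i \<le> N"
    unfolding i_def using assms(3) by (auto intro: LeastI Least_le)
  have "i \<noteq> 0" using i assms(2) grid_prev_less[OF k] by (cases i) auto
  then obtain j where j: "i = Suc j" by (cases i) auto
  then have jN: "j < N" using i by simp
  have "\<not> \<tau> k \<le> t j" using not_less_Least[of j "\<lambda>i. \<tau> k \<le> t i"] j i_def by auto
  moreover obtain p where p: "p \<le> K" "t j = \<tau> p" using visit_on_grid[of j] jN by auto
  ultimately have pk: "p < k" using k grid_le_iff[of k p] by auto
  obtain q where q: "q \<le> K" "t (Suc j) = \<tau> q" using visit_on_grid[of "Suc j"] jN by auto
  have kq: "k \<le> q" using i j q k grid_le_iff[of k q] by auto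
  have le: "t j \<le> \<tau> (k - 1)" "\<tau> k \<le> t (Suc j)"
    using pk k kq q p i j by (auto simp: grid_le_iff)
  show ?thesis
    using that[OF jN p(2) q(2) pk kq q(1)] left_end_eq[OF jN le k] right_end_eq[OF jN le k]
      state_at_visit[of j] state_at_visit[of "Suc j"] jN p q grid_index_eq[OF q(1)]
    by simp
qed

section \<open>Conditional probabilities in a bin\<close>

abbreviation P :: "real \<Rightarrow> real \<Rightarrow> real^'s^'s" where
  "P \<equiv> trans_prob \<tau> K \<alpha>"

text \<open>Acyclicity rules out loops. A permitted transition therefore corresponds to an
  off-diagonal entry of the step matrix, which is the jump itself.\<close>

lemma reach_offdiag: "g \<in> reach V h \<Longrightarrow> g \<noteq> h"
  using acyclic by (auto simp: reach_def acyclic_def)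

text \<open>The probability that a subject in state \<open>u\<close> at \<open>\<tau> i\<close> yields the observation \<open>b\<close> at \<open>\<tau> q\<close>,
  which for \<open>b \<in> E\<close> requires a transition at that very time.\<close>

definition visit_prob :: "'s \<Rightarrow> nat \<Rightarrow> nat \<Rightarrow> 's \<Rightarrow> real" where
  "visit_prob b q i u =
    (if b \<notin> E then P (\<tau> i) (\<tau> q) $ u $ b
     else \<Sum>m\<in>reach V b. \<alpha> q m b * P (\<tau> i) (\<tau> (q - 1)) $ u $ m)"

section \<open>Transition matrices across one observational interval\<close>

context
  fixes j p q
  assumes j: "j < N" "t j = \<tau> p" "t (Suc j) = \<tau> q" and pq: "p < q" "q \<le> K"
begin

lemma visit_constraint_inside: "p < i \<Longrightarrow> i < q \<Longrightarrow> visit_constraint i u v"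
proof -
  assume i: "p < i" "i < q"
  have "False" if "j' \<le> N" "t j' = \<tau> i" for j'
  proof -
    have "t j < t j'" "t j' < t (Suc j)" using i that j pq by (simp_all add: grid_less_iff)
    then have "\<not> j' \<le> j" "\<not> Suc j \<le> j'" using that j visit_le[of j' j] visit_le[of "Suc j" j'] by auto
    then show False by simp
  qed
  then show ?thesis by (auto simp: visit_constraint_def)
qed

lemma visit_constraint_end:
  "visit_constraint q u v \<longleftrightarrow> v = x (Suc j) \<and> (x (Suc j) \<in> E \<longrightarrow> u \<in> reach V (x (Suc j)))"
proof -
  have "i = Suc j" if "i \<le> N" "t i = \<tau> q" for i
    using that j visit_eq_iff[of i "Suc j"] by simp
  then show ?thesis using j grid_pos[of q] pq by (auto simp: visit_constraint_def)
qed

lemma visit_constraint_start: "visit_constraint p u v \<Longrightarrow> v = x j"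
  using j by (auto simp: visit_constraint_def)

lemma constrained_factor_inside:
  "p < i \<Longrightarrow> i < q \<Longrightarrow> constrained_factor visit_constraint i = step_factor \<alpha> i"
  by (simp add: constrained_factor_def visit_constraint_inside)

text \<open>The factors before \<open>q\<close> are unrestricted and multiply to a product integral.
  Only the last factor feels the observation: its column \<open>b\<close> is kept whole if
  \<open>b \<notin> E\<close>, and reduced to the rows in \<open>reach V b\<close> otherwise. For
  this factor to be present, \<open>i < q\<close> is required.\<close>

lemma mat_prod_visit_prob:
  assumes i: "p \<le> i" "i < q"
  shows "mat_prod (constrained_factor visit_constraint) i q $ u $ x (Suc j) = visit_prob (x (Suc j)) q i u"
proof -
  let ?b = "x (Suc j)"
  have split: "mat_prod F i q = mat_prod F i (q - 1) ** F q" for F :: "nat \<Rightarrow> real^'s^'s"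
    using mat_prod_Suc[of i "q - 1" F] i by simp
  have "mat_prod (constrained_factor visit_constraint) i (q - 1) = mat_prod (step_factor \<alpha>) i (q - 1)"
    using i by (intro mat_prod_cong constrained_factor_inside) auto
  also have "\<dots> = P (\<tau> i) (\<tau> (q - 1))"
    using i pq by (intro trans_prob_grid[symmetric]) auto
  finally have *: "mat_prod (constrained_factor visit_constraint) i q $ u $ ?b =
      (\<Sum>m\<in>UNIV. P (\<tau> i) (\<tau> (q - 1)) $ u $ m * constrained_factor visit_constraint q $ m $ ?b)"
    by (simp add: split matrix_matrix_mult_def)
  show ?thesis
  proof (cases "?b \<in> E")
    case False
    have "P (\<tau> i) (\<tau> q) = P (\<tau> i) (\<tau> (q - 1)) ** step_factor \<alpha> q"
      using i pq by (simp add: trans_prob_grid split)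
    with False * show ?thesis
      by (simp add: visit_prob_def constrained_factor_def visit_constraint_end matrix_matrix_mult_def)
  next
    case True
    have "mat_prod (constrained_factor visit_constraint) i q $ u $ ?b =
        (\<Sum>m\<in>UNIV. if m \<in> reach V ?b then \<alpha> q m ?b * P (\<tau> i) (\<tau> (q - 1)) $ u $ m else 0)"
      unfolding * using True pq reach_offdiag[of _ ?b]
      by (intro sum.cong) (auto simp: constrained_factor_def visit_constraint_end step_factor_offdiag)
    with True show ?thesis by (simp add: visit_prob_def sum.If_cases)
  qed
qed

text \<open>The product is cut before and after index \<open>k\<close>. Since \<open>e\<close>
  affects the factor at \<open>k\<close> alone, it turns into a weight in the double sum. That
  factor keeps its visit constraint because \<open>k = q\<close> is allowed.\<close>

lemma mat_prod_refined:
  assumes k: "p < k" "k \<le> q"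
  shows "mat_prod (constrained_factor (refined_constraint k e)) p q $ u $ v =
    (\<Sum>g\<in>UNIV. \<Sum>h\<in>UNIV. of_bool (e g h) * (P (\<tau> p) (\<tau> (k - 1)) $ u $ g *
       constrained_factor visit_constraint k $ g $ h *
       mat_prod (constrained_factor visit_constraint) k q $ h $ v))"
proof -
  let ?R = "constrained_factor (refined_constraint k e)" and ?F = "constrained_factor visit_constraint"
  have other: "?R i = ?F i" if "i \<noteq> k" for i
    using that by (simp add: constrained_factor_def refined_constraint_def)
  have "mat_prod ?R p (k - 1) = mat_prod (step_factor \<alpha>) p (k - 1)"
    using k by (intro mat_prod_cong) (auto simp: other constrained_factor_inside)
  also have "\<dots> = P (\<tau> p) (\<tau> (k - 1))"
    using k pq by (intro trans_prob_grid[symmetric]) auto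
  finally have before: "mat_prod ?R p (k - 1) = P (\<tau> p) (\<tau> (k - 1))" .
  have after: "mat_prod ?R k q = mat_prod ?F k q"
    by (intro mat_prod_cong) (simp add: other)
  have at: "?R k $ g $ h = of_bool (e g h) * ?F k $ g $ h" for g h
    by (auto simp: constrained_factor_def refined_constraint_def)
  have "mat_prod ?R p q = mat_prod ?R p (k - 1) ** (?R k ** mat_prod ?R k q)"
    using mat_prod_append[of p "k - 1" q ?R] mat_prod_append[of "k - 1" k q ?R]
      mat_prod_single[of k ?R] k by simp
  then have "mat_prod ?R p q = P (\<tau> p) (\<tau> (k - 1)) ** (?R k ** mat_prod ?F k q)"
    by (simp only: before after)
  then show ?thesis
    by (simp add: at matrix_matrix_mult_def sum_distrib_left mult_ac)
qed

text \<open>Being at risk leaves the state at \<open>\<tau> k\<close> free, so the factor at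
  \<open>k\<close> recombines with the later ones to a product starting at \<open>k - 1\<close>.
  This is why no separate case for \<open>k = q\<close> arises.\<close>

lemma mat_prod_at_risk:
  assumes k: "p < k" "k \<le> q"
  shows "mat_prod (constrained_factor (refined_constraint k (\<lambda>u v. u = g))) p q $ x j $ x (Suc j) =
    P (\<tau> p) (\<tau> (k - 1)) $ x j $ g * visit_prob (x (Suc j)) q (k - 1) g"
proof -
  let ?F = "constrained_factor visit_constraint"
  have "mat_prod ?F (k - 1) q = ?F k ** mat_prod ?F k q"
    using mat_prod_append[of "k - 1" k q ?F] mat_prod_single[of k ?F] k by simp
  then have "visit_prob (x (Suc j)) q (k - 1) g = (\<Sum>h\<in>UNIV. ?F k $ g $ h * mat_prod ?F k q $ h $ x (Suc j))"
    using k by (subst mat_prod_visit_prob[symmetric]) (auto simp: matrix_matrix_mult_def)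
  moreover have "mat_prod (constrained_factor (refined_constraint k (\<lambda>u v. u = g))) p q $ x j $ x (Suc j) =
      (\<Sum>u\<in>UNIV. of_bool (u = g) * (P (\<tau> p) (\<tau> (k - 1)) $ x j $ u *
        (\<Sum>h\<in>UNIV. ?F k $ u $ h * mat_prod ?F k q $ h $ x (Suc j))))"
    by (simp only: mat_prod_refined[OF k] sum_distrib_left mult.assoc)
  moreover have "\<dots> = P (\<tau> p) (\<tau> (k - 1)) $ x j $ g *
        (\<Sum>h\<in>UNIV. ?F k $ g $ h * mat_prod ?F k q $ h $ x (Suc j))"
    by (subst sum_supported_at[of g]) auto
  ultimately show ?thesis by simp
qed

lemma mat_prod_transition:
  assumes k: "p < k" "k \<le> q" and gh: "(g, h) \<in> V"
  shows "mat_prod (constrained_factor (refined_constraint k (\<lambda>u v. u = g \<and> v = h))) p q $ x j $ x (Suc j) =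
    P (\<tau> p) (\<tau> (k - 1)) $ x j $ g * \<alpha> k g h *
      (if k < q then visit_prob (x (Suc j)) q k h else of_bool (h = x (Suc j)))"
proof -
  let ?F = "constrained_factor visit_constraint"
  have "g \<noteq> h" using reach_offdiag[of g h] gh by (simp add: reach_def)
  then have step: "step_factor \<alpha> k $ g $ h = \<alpha> k g h"
    using k pq by (intro step_factor_offdiag) auto
  have "mat_prod (constrained_factor (refined_constraint k (\<lambda>u v. u = g \<and> v = h))) p q $ x j $ x (Suc j) =
      (\<Sum>u\<in>UNIV. of_bool (u = g) * (\<Sum>v\<in>UNIV. of_bool (v = h) * (P (\<tau> p) (\<tau> (k - 1)) $ x j $ u *
        ?F k $ u $ v * mat_prod ?F k q $ v $ x (Suc j))))"
    by (simp only: mat_prod_refined[OF k] sum_distrib_left of_bool_conj mult.assoc)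
  also have "\<dots> = P (\<tau> p) (\<tau> (k - 1)) $ x j $ g * ?F k $ g $ h * mat_prod ?F k q $ h $ x (Suc j)"
    by (subst sum_supported_at[of g], simp, subst sum_supported_at[of h], simp) simp
  also have "\<dots> = P (\<tau> p) (\<tau> (k - 1)) $ x j $ g * \<alpha> k g h *
      (if k < q then visit_prob (x (Suc j)) q k h else of_bool (h = x (Suc j)))"
  proof (cases "k < q")
    case True
    then show ?thesis using k by (simp add: constrained_factor_inside mat_prod_visit_prob step)
  next
    case False
    then have "k = q" using k by simp
    \<comment> \<open>No factor follows \<open>k\<close>, so the remaining product is the identity
      and forces \<open>h = x (Suc j)\<close>. The requirement that \<open>g\<close> be in
      \<open>reach V (x (Suc j))\<close> is then met by \<open>gh\<close>.\<close>
    then show ?thesis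
      using gh step by (auto simp: constrained_factor_def visit_constraint_end mat_def reach_def)
  qed
  finally show ?thesis .
qed

lemma cond_prob_at_risk:
  assumes k: "p < k" "k \<le> q" and pos: "0 < prob observed"
  shows "prob ({\<omega>\<in>space M. left_state (\<lambda>u. X u \<omega>) (\<tau> k) = g} \<inter> observed) / prob observed =
    P (\<tau> p) (\<tau> (k - 1)) $ x j $ g * visit_prob (x (Suc j)) q (k - 1) g / visit_prob (x (Suc j)) q p (x j)"
proof -
  have kK: "k \<in> {1..K}" using k pq by auto
  have "\<P>(\<omega> in M. constrained (refined_constraint k (\<lambda>u v. u = g)) K \<omega>) /
      \<P>(\<omega> in M. constrained visit_constraint K \<omega>) =
    mat_prod (constrained_factor (refined_constraint k (\<lambda>u v. u = g))) p q $ x j $ x (Suc j) /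
    mat_prod (constrained_factor visit_constraint) p q $ x j $ x (Suc j)"
    using k cond_prob_bin_event(2)[OF kK pos]
    by (intro prob_constrained_ratio pq)
      (auto simp: refined_constraint_def fun_eq_iff visit_constraint_end dest: visit_constraint_start)
  then show ?thesis
    using cond_prob_bin_event(1)[OF kK pos, of "\<lambda>u v. u = g"] pq
    by (simp add: mat_prod_at_risk[OF k] mat_prod_visit_prob)
qed

lemma cond_prob_transition:
  assumes k: "p < k" "k \<le> q" and gh: "(g, h) \<in> V" and pos: "0 < prob observed"
  shows "prob ({\<omega>\<in>space M. left_state (\<lambda>u. X u \<omega>) (\<tau> k) = g \<and> X (\<tau> k) \<omega> = h} \<inter> observed) / prob observed =
    P (\<tau> p) (\<tau> (k - 1)) $ x j $ g * \<alpha> k g h *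
      (if k < q then visit_prob (x (Suc j)) q k h else of_bool (h = x (Suc j))) / visit_prob (x (Suc j)) q p (x j)"
proof -
  have kK: "k \<in> {1..K}" using k pq by auto
  have "\<P>(\<omega> in M. constrained (refined_constraint k (\<lambda>u v. u = g \<and> v = h)) K \<omega>) /
      \<P>(\<omega> in M. constrained visit_constraint K \<omega>) =
    mat_prod (constrained_factor (refined_constraint k (\<lambda>u v. u = g \<and> v = h))) p q $ x j $ x (Suc j) /
    mat_prod (constrained_factor visit_constraint) p q $ x j $ x (Suc j)"
    using k cond_prob_bin_event(2)[OF kK pos]
    by (intro prob_constrained_ratio pq)
      (auto simp: refined_constraint_def fun_eq_iff visit_constraint_end dest: visit_constraint_start)
  then show ?thesis
    using cond_prob_bin_event(1)[OF kK pos, of "\<lambda>u v. u = g \<and> v = h"] pq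
    by (simp add: mat_prod_transition[OF k gh] mat_prod_visit_prob)
qed

end

lemma cond_prob_bin:
  assumes k: "k \<in> {1..K}" and within: "t 0 \<le> \<tau> (k - 1)" "\<tau> k \<le> t N" and pos: "0 < prob observed"
  shows
    "let l = left_end \<tau> N t k;
         r = right_end \<tau> N t k;
         a = state_at N t x l;
         b = state_at N t x r;
         kr = grid_index \<tau> K r
     in
       (\<forall>(g, h)\<in>V.
          prob ({\<omega>\<in>space M. left_state (\<lambda>u. X u \<omega>) (\<tau> k) = g \<and> X (\<tau> k) \<omega> = h} \<inter> observed) / prob observed =
          (if b \<notin> E then
             P l (\<tau> (k - 1)) $ a $ g * \<alpha> k g h * P (\<tau> k) r $ h $ b / P l r $ a $ b
           else if k < kr then
             P l (\<tau> (k - 1)) $ a $ g * \<alpha> k g h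
               * (\<Sum>m\<in>reach V b. \<alpha> kr m b * P (\<tau> k) (\<tau> (kr - 1)) $ h $ m)
             / (\<Sum>m\<in>reach V b. \<alpha> kr m b * P l (\<tau> (kr - 1)) $ a $ m)
           else
             P l (\<tau> (k - 1)) $ a $ g * \<alpha> k g h * of_bool (h = b)
             / (\<Sum>m\<in>reach V b. \<alpha> kr m b * P l (\<tau> (kr - 1)) $ a $ m))) \<and>
       (\<forall>g.
          prob ({\<omega>\<in>space M. left_state (\<lambda>u. X u \<omega>) (\<tau> k) = g} \<inter> observed) / prob observed =
          (if b \<notin> E then
             P l (\<tau> (k - 1)) $ a $ g * P (\<tau> (k - 1)) r $ g $ b / P l r $ a $ b
           else
             P l (\<tau> (k - 1)) $ a $ g
               * (\<Sum>m\<in>reach V b. \<alpha> kr m b * P (\<tau> (k - 1)) (\<tau> (kr - 1)) $ g $ m)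
             / (\<Sum>m\<in>reach V b. \<alpha> kr m b * P l (\<tau> (kr - 1)) $ a $ m)))"
proof -
  obtain j p q where j: "j < N" "t j = \<tau> p" "t (Suc j) = \<tau> q" and pkq: "p < k" "k \<le> q" "q \<le> K"
    and ends: "left_end \<tau> N t k = \<tau> p" "right_end \<tau> N t k = \<tau> q" "state_at N t x (\<tau> p) = x j"
      "state_at N t x (\<tau> q) = x (Suc j)" "grid_index \<tau> K (\<tau> q) = q"
    using obs_interval[OF k within] .
  have pq: "p < q" using pkq by simp
  \<comment> \<open>For an end state outside \<open>E\<close>, this lets the formula with
    \<open>P (\<tau> k) (\<tau> q)\<close> include the case \<open>k = q\<close>, where its entry is
    1 if \<open>h\<close> is the end state and 0 otherwise.\<close>
  have same: "P (\<tau> q) (\<tau> q) = mat 1"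
    using trans_prob_grid[of q q \<alpha>] pkq by simp
  have trans: "prob ({\<omega>\<in>space M. left_state (\<lambda>u. X u \<omega>) (\<tau> k) = g \<and> X (\<tau> k) \<omega> = h} \<inter> observed) / prob observed =
      (if x (Suc j) \<notin> E then
         P (\<tau> p) (\<tau> (k - 1)) $ x j $ g * \<alpha> k g h * P (\<tau> k) (\<tau> q) $ h $ x (Suc j) / P (\<tau> p) (\<tau> q) $ x j $ x (Suc j)
       else if k < q then
         P (\<tau> p) (\<tau> (k - 1)) $ x j $ g * \<alpha> k g h
           * (\<Sum>m\<in>reach V (x (Suc j)). \<alpha> q m (x (Suc j)) * P (\<tau> k) (\<tau> (q - 1)) $ h $ m)
         / (\<Sum>m\<in>reach V (x (Suc j)). \<alpha> q m (x (Suc j)) * P (\<tau> p) (\<tau> (q - 1)) $ x j $ m)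
       else
         P (\<tau> p) (\<tau> (k - 1)) $ x j $ g * \<alpha> k g h * of_bool (h = x (Suc j))
         / (\<Sum>m\<in>reach V (x (Suc j)). \<alpha> q m (x (Suc j)) * P (\<tau> p) (\<tau> (q - 1)) $ x j $ m))"
    if "(g, h) \<in> V" for g h
  proof (cases "k < q")
    case True
    then show ?thesis
      unfolding cond_prob_transition[OF j pq pkq(3,1,2) that pos] by (simp add: visit_prob_def)
  next
    case False
    then have "k = q" using pkq by simp
    then show ?thesis
      unfolding cond_prob_transition[OF j pq pkq(3,1,2) that pos] by (simp add: visit_prob_def same mat_def)
  qed
  have risk: "prob ({\<omega>\<in>space M. left_state (\<lambda>u. X u \<omega>) (\<tau> k) = g} \<inter> observed) / prob observed =
      (if x (Suc j) \<notin> E then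
         P (\<tau> p) (\<tau> (k - 1)) $ x j $ g * P (\<tau> (k - 1)) (\<tau> q) $ g $ x (Suc j) / P (\<tau> p) (\<tau> q) $ x j $ x (Suc j)
       else
         P (\<tau> p) (\<tau> (k - 1)) $ x j $ g
           * (\<Sum>m\<in>reach V (x (Suc j)). \<alpha> q m (x (Suc j)) * P (\<tau> (k - 1)) (\<tau> (q - 1)) $ g $ m)
         / (\<Sum>m\<in>reach V (x (Suc j)). \<alpha> q m (x (Suc j)) * P (\<tau> p) (\<tau> (q - 1)) $ x j $ m))" for g
    unfolding cond_prob_at_risk[OF j pq pkq(3,1,2) pos] by (simp add: visit_prob_def)
  show ?thesis
    unfolding Let_def ends using trans risk by blast
qed

lemma trans_count_measurable: "k \<in> {1..K} \<Longrightarrow> trans_count \<tau> X k g h \<in> borel_measurable M"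
  and at_risk_measurable: "k \<in> {1..K} \<Longrightarrow> at_risk \<tau> X k g \<in> borel_measurable M"
proof -
  assume k: "k \<in> {1..K}"
  note [measurable] = left_state_measurable[OF grid_pos[OF k]] X_grid_measurable[of k]
  have kK: "k \<le> K" using k by simp
  show "trans_count \<tau> X k g h \<in> borel_measurable M"
    unfolding trans_count_def[abs_def] using kK by measurable
  show "at_risk \<tau> X k g \<in> borel_measurable M"
    unfolding at_risk_def[abs_def] by measurable
qed

lemma bin_event_Int_observed:
  assumes "k \<in> {1..K}"
  shows "{\<omega>\<in>space M. e (left_state (\<lambda>u. X u \<omega>) (\<tau> k)) (X (\<tau> k) \<omega>)} \<inter> observed \<in> subject_events M X W N"
proof -
  have "process_events M X \<subseteq> subject_events M X W N"
    unfolding process_events_def subject_events_def by (intro sigma_sets_mono') auto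
  then show ?thesis
    using bin_event_process_events[OF assms, of e] observed_subject_events
    by (auto simp: sets_subject_algebra[symmetric])
qed

end

section \<open>Conditioning on several subjects and linearity\<close>

lemma (in prob_space) cond_expect_of_bool:
  assumes "{\<omega>\<in>space M. Q \<omega>} \<in> events" "0 < prob B"
  shows "cond_expect M B (\<lambda>\<omega>. of_bool (Q \<omega>)) = prob ({\<omega>\<in>space M. Q \<omega>} \<inter> B) / prob B"
proof -
  let ?U = "uniform_measure M B"
  have B: "emeasure M B \<noteq> 0" "emeasure M B \<noteq> \<infinity>"
    using assms(2) by (auto simp: emeasure_eq_measure)
  have "cond_expect M B (\<lambda>\<omega>. of_bool (Q \<omega>)) = integral\<^sup>L ?U (indicator {\<omega>\<in>space M. Q \<omega>})"
    unfolding cond_expect_def by (intro Bochner_Integration.integral_cong) (auto simp: indicator_def)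
  also have "\<dots> = measure ?U ({\<omega>\<in>space M. Q \<omega>} \<inter> space ?U)"
    by simp
  also have "{\<omega>\<in>space M. Q \<omega>} \<inter> space ?U = {\<omega>\<in>space M. Q \<omega>}" by auto
  finally show ?thesis
    using measure_uniform_measure[OF B assms(1)] by (simp add: Int_commute)
qed

text \<open>Replacing \<open>B i\<close> by \<open>A \<inter> B i\<close> changes one factor of a
  product of probabilities. The other factors are nonzero by \<open>pos\<close> and cancel.\<close>

lemma (in prob_space) indep_sets_cond_prob:
  assumes indep: "indep_sets F I" and I: "finite I" "i \<in> I"
    and B: "\<And>j. j \<in> I \<Longrightarrow> B j \<in> F j" and A: "A \<inter> B i \<in> F i"
    and pos: "0 < prob (\<Inter>j\<in>I. B j)"
  shows "prob (A \<inter> (\<Inter>j\<in>I. B j)) / prob (\<Inter>j\<in>I. B j) = prob (A \<inter> B i) / prob (B i)"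
    and "0 < prob (B i)"
proof -
  let ?C = "B(i := A \<inter> B i)"
  have "A \<inter> (\<Inter>j\<in>I. B j) = (\<Inter>j\<in>I. ?C j)" using I by (auto split: if_splits)
  moreover have "prob (\<Inter>j\<in>I. ?C j) = (\<Prod>j\<in>I. prob (?C j))"
    using I B A by (intro indep_setsD[OF indep]) auto
  moreover have "\<dots> = prob (A \<inter> B i) * (\<Prod>j\<in>I - {i}. prob (B j))"
    using I by (simp add: prod.remove[of I i])
  moreover have B_eq: "prob (\<Inter>j\<in>I. B j) = prob (B i) * (\<Prod>j\<in>I - {i}. prob (B j))"
    using I B by (subst indep_setsD[OF indep]) (auto simp: prod.remove[of I i])
  ultimately show "prob (A \<inter> (\<Inter>j\<in>I. B j)) / prob (\<Inter>j\<in>I. B j) = prob (A \<inter> B i) / prob (B i)"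
    "0 < prob (B i)"
    using pos by (auto simp: zero_less_measure_iff)
qed

text \<open>All summands are nonpositive, so the sum can be moved to \<open>ennreal\<close>, where
  infinite values obey the usual laws of sums and products.\<close>

lemma sum_uminus_enn2ereal:
  assumes "\<And>i. i \<in> I \<Longrightarrow> 0 \<le> d i" "\<And>i. i \<in> I \<Longrightarrow> 0 \<le> y i"
  shows "(\<Sum>i\<in>I. ereal (d i) * - enn2ereal (c i) - ereal (y i)) =
    - enn2ereal (\<Sum>i\<in>I. ennreal (d i) * c i + ennreal (y i))"
  using assms
proof (induction I rule: infinite_finite_induct)
  case (insert i I)
  have neg_add: "- u + - v = - (u + v)" if "0 \<le> u" "0 \<le> v" for u v :: ereal
    using that by (cases u v rule: ereal2_cases) auto
  have "ereal (d i) * - enn2ereal (c i) - ereal (y i) =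
      - (ereal (d i) * enn2ereal (c i)) + - ereal (y i)"
    by (simp add: minus_ereal_def)
  also have "\<dots> = - enn2ereal (ennreal (d i) * c i + ennreal (y i))"
    using insert.prems by (subst neg_add) (auto simp: plus_ennreal.rep_eq times_ennreal.rep_eq enn2ereal_ennreal)
  finally show ?case
    using insert by (simp add: neg_add plus_ennreal.rep_eq)
qed (simp_all add: zero_ennreal.rep_eq)

text \<open>The positive part of the sum is 0, so the expectation is minus a nonnegative integral,
  which is linear even if some \<open>c i\<close> is \<open>-\<infinity>\<close>. If
  \<open>d i\<close> vanishes almost surely, 0 times infinity is 0 on both sides.\<close>

lemma (in prob_space) ereal_expectation_sum_nonpos:
  assumes I: "finite I" and c: "\<And>i. i \<in> I \<Longrightarrow> c i \<le> 0" and a: "\<And>i. i \<in> I \<Longrightarrow> 0 \<le> a i"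
    and d: "\<And>i. i \<in> I \<Longrightarrow> integrable M (d i)" "\<And>i \<omega>. i \<in> I \<Longrightarrow> 0 \<le> d i \<omega>"
    and y: "\<And>i. i \<in> I \<Longrightarrow> integrable M (y i)" "\<And>i \<omega>. i \<in> I \<Longrightarrow> 0 \<le> y i \<omega>"
  shows "ereal_expectation M (\<lambda>\<omega>. \<Sum>i\<in>I. ereal (d i \<omega>) * c i - ereal (a i * y i \<omega>)) =
    (\<Sum>i\<in>I. ereal (expectation (d i)) * c i - ereal (a i * expectation (y i)))"
proof -
  let ?C = "\<lambda>i. e2ennreal (- c i)"
  let ?f = "\<lambda>\<omega>. \<Sum>i\<in>I. ennreal (d i \<omega>) * ?C i + ennreal (a i * y i \<omega>)"
  have C: "c i = - enn2ereal (?C i)" if "i \<in> I" for i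
    using c[OF that] by (simp add: enn2ereal_e2ennreal ereal_uminus_le_reorder)
  have sum_C: "(\<Sum>i\<in>I. ereal (u i) * c i - ereal (v i)) = - enn2ereal (\<Sum>i\<in>I. ennreal (u i) * ?C i + ennreal (v i))"
    if "\<And>i. i \<in> I \<Longrightarrow> 0 \<le> u i" "\<And>i. i \<in> I \<Longrightarrow> 0 \<le> v i" for u v
  proof -
    have "(\<Sum>i\<in>I. ereal (u i) * c i - ereal (v i)) = (\<Sum>i\<in>I. ereal (u i) * - enn2ereal (?C i) - ereal (v i))"
      by (intro sum.cong refl) (metis C)
    then show ?thesis using that by (simp only: sum_uminus_enn2ereal)
  qed
  have f: "(\<Sum>i\<in>I. ereal (d i \<omega>) * c i - ereal (a i * y i \<omega>)) = - enn2ereal (?f \<omega>)" for \<omega>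
    using a d y by (intro sum_C) auto
  have "(\<integral>\<^sup>+\<omega>. ?f \<omega> \<partial>M) = (\<Sum>i\<in>I. ennreal (expectation (d i)) * ?C i + ennreal (a i * expectation (y i)))"
  proof -
    have [measurable]: "d i \<in> borel_measurable M" "y i \<in> borel_measurable M" if "i \<in> I" for i
      using d(1)[OF that] y(1)[OF that] by auto
    have "(\<integral>\<^sup>+\<omega>. ?f \<omega> \<partial>M) = (\<Sum>i\<in>I. \<integral>\<^sup>+\<omega>. (ennreal (d i \<omega>) * ?C i + ennreal (a i * y i \<omega>)) \<partial>M)"
      by (intro nn_integral_sum) measurable
    also have "\<dots> = (\<Sum>i\<in>I. ennreal (expectation (d i)) * ?C i + ennreal (a i * expectation (y i)))"
    proof (intro sum.cong refl)
      fix i assume i: "i \<in> I"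
      note [measurable] = borel_measurable_integrable[OF d(1)[OF i]] borel_measurable_integrable[OF y(1)[OF i]]
      have "(\<integral>\<^sup>+\<omega>. (ennreal (d i \<omega>) * ?C i + ennreal (a i * y i \<omega>)) \<partial>M) =
          (\<integral>\<^sup>+\<omega>. ennreal (d i \<omega>) \<partial>M) * ?C i + (\<integral>\<^sup>+\<omega>. ennreal (a i * y i \<omega>) \<partial>M)"
        by (simp add: nn_integral_add nn_integral_multc)
      also have "(\<integral>\<^sup>+\<omega>. ennreal (d i \<omega>) \<partial>M) = ennreal (expectation (d i))"
        using d i by (intro nn_integral_eq_integral) auto
      also have "(\<integral>\<^sup>+\<omega>. ennreal (a i * y i \<omega>) \<partial>M) = ennreal (expectation (\<lambda>\<omega>. a i * y i \<omega>))"
        using a y i by (intro nn_integral_eq_integral) auto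
      finally show "(\<integral>\<^sup>+\<omega>. (ennreal (d i \<omega>) * ?C i + ennreal (a i * y i \<omega>)) \<partial>M) =
          ennreal (expectation (d i)) * ?C i + ennreal (a i * expectation (y i))"
        by simp
    qed
    finally show ?thesis .
  qed
  moreover have "(\<integral>\<^sup>+\<omega>. e2ennreal (- enn2ereal (?f \<omega>)) \<partial>M) = 0"
    by (simp add: e2ennreal_neg)
  ultimately have "ereal_expectation M (\<lambda>\<omega>. \<Sum>i\<in>I. ereal (d i \<omega>) * c i - ereal (a i * y i \<omega>)) =
      - enn2ereal (\<Sum>i\<in>I. ennreal (expectation (d i)) * ?C i + ennreal (a i * expectation (y i)))"
    by (simp add: ereal_expectation_def f zero_ennreal.rep_eq)
  also have "\<dots> = (\<Sum>i\<in>I. ereal (expectation (d i)) * c i - ereal (a i * expectation (y i)))"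
    using a d y by (intro sum_C[symmetric]) (auto intro!: mult_nonneg_nonneg Bochner_Integration.integral_nonneg)
  finally show ?thesis .
qed

text \<open>The formulas for a subject concern the bins between its first and last visit. For any
  other bin, the set of visit times in \<open>left_end\<close> or \<open>right_end\<close> is empty
  and there is no observational interval.\<close>

theorem proposition3:
  fixes M :: "'w measure"
    and V :: "('s::finite \<times> 's) set" and E :: "'s set"
    and n :: nat and N :: "nat \<Rightarrow> nat"
    and t :: "nat \<Rightarrow> nat \<Rightarrow> real" and x :: "nat \<Rightarrow> nat \<Rightarrow> 's"
    and \<tau> :: "nat \<Rightarrow> real" and K :: nat
    and X :: "nat \<Rightarrow> real \<Rightarrow> 'w \<Rightarrow> 's" and W :: "nat \<Rightarrow> nat \<Rightarrow> 'w \<Rightarrow> ereal"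
    and \<alpha> \<alpha>' :: "'s jumps"
    and P :: "real \<Rightarrow> real \<Rightarrow> real^'s^'s" and Obs :: "'w set"
  defines "P \<equiv> trans_prob \<tau> K \<alpha>'"
    and "Obs \<equiv> {\<omega>\<in>space M. \<forall>i\<in>{1..n}. \<omega> \<in> obs_subject M V E (X i) (W i) (N i) (t i) (x i)}"
  assumes "prob_space M"
    and "acyclic V"
    and "valid_jumps V K \<alpha>" and "valid_jumps V K \<alpha>'"
    and "\<And>i j. i \<in> {1..n} \<Longrightarrow> j < N i \<Longrightarrow> t i j < t i (Suc j)"
    and "\<tau> 0 = 0" and "strict_mono_on {0..K} \<tau>"
    and "\<tau> ` {0..K} = {t i j | i j. i \<in> {1..n} \<and> j \<le> N i}"
    and "\<And>i. i \<in> {1..n} \<Longrightarrow> markov_process M (X i) P"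
    and "prob_space.indep_sets M (\<lambda>i. subject_events M (X i) (W i) (N i)) {1..n}"
    and "\<And>i. i \<in> {1..n} \<Longrightarrow> cond_indep_visits M V E (X i) (W i) (N i) (t i) (x i)"
    and "0 < measure M Obs"
  shows
    "ereal_cond_expect M Obs (complete_loglik V \<tau> K n X \<alpha>) =
       (\<Sum>k=1..K. \<Sum>(g, h)\<in>V.
          ereal (cond_expect M Obs (total_count \<tau> n X k g h)) * ext_ln (\<alpha> k g h)
          - ereal (\<alpha> k g h * cond_expect M Obs (total_at_risk \<tau> n X k g)))
     \<and> (\<forall>k\<in>{1..K}.
          (\<forall>(g, h)\<in>V. cond_expect M Obs (total_count \<tau> n X k g h)
             = (\<Sum>i=1..n. cond_expect M Obs (trans_count \<tau> (X i) k g h))) \<and>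
          (\<forall>g. cond_expect M Obs (total_at_risk \<tau> n X k g)
             = (\<Sum>i=1..n. cond_expect M Obs (at_risk \<tau> (X i) k g))))
     \<and> (\<forall>k\<in>{1..K}. \<forall>i\<in>{1..n}. t i 0 \<le> \<tau> (k - 1) \<and> \<tau> k \<le> t i (N i) \<longrightarrow>
          (let l = left_end \<tau> (N i) (t i) k;
               r = right_end \<tau> (N i) (t i) k;
               a = state_at (N i) (t i) (x i) l;
               b = state_at (N i) (t i) (x i) r;
               kr = grid_index \<tau> K r
           in
             (\<forall>(g, h)\<in>V. cond_expect M Obs (trans_count \<tau> (X i) k g h) =
                (if b \<notin> E then
                   P l (\<tau> (k - 1)) $ a $ g * \<alpha>' k g h * P (\<tau> k) r $ h $ b / P l r $ a $ b
                 else if k < kr then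
                   P l (\<tau> (k - 1)) $ a $ g * \<alpha>' k g h
                     * (\<Sum>m\<in>reach V b. \<alpha>' kr m b * P (\<tau> k) (\<tau> (kr - 1)) $ h $ m)
                   / (\<Sum>m\<in>reach V b. \<alpha>' kr m b * P l (\<tau> (kr - 1)) $ a $ m)
                 else
                   P l (\<tau> (k - 1)) $ a $ g * \<alpha>' k g h * of_bool (h = b)
                   / (\<Sum>m\<in>reach V b. \<alpha>' kr m b * P l (\<tau> (kr - 1)) $ a $ m))) \<and>
             (\<forall>g. cond_expect M Obs (at_risk \<tau> (X i) k g) =
                (if b \<notin> E then
                   P l (\<tau> (k - 1)) $ a $ g * P (\<tau> (k - 1)) r $ g $ b / P l r $ a $ b
                 else
                   P l (\<tau> (k - 1)) $ a $ g
                     * (\<Sum>m\<in>reach V b. \<alpha>' kr m b * P (\<tau> (k - 1)) (\<tau> (kr - 1)) $ g $ m)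
                   / (\<Sum>m\<in>reach V b. \<alpha>' kr m b * P l (\<tau> (kr - 1)) $ a $ m)))))"
proof -
  interpret prob_space M by fact
  note jumps = \<open>valid_jumps V K \<alpha>\<close> and pos = \<open>0 < measure M Obs\<close>
  let ?B = "\<lambda>i. obs_subject M V E (X i) (W i) (N i) (t i) (x i)"
  let ?U = "uniform_measure M Obs"
  have subject: "observed_subject M \<tau> K (X i) \<alpha>' V E (W i) (N i) (t i) (x i)" if i: "i \<in> {1..n}" for i
  proof unfold_locales
    show "markov_process M (X i) (trans_prob \<tau> K \<alpha>')"
      using assms(11)[OF i] by (simp add: P_def)
    show "t i j \<in> \<tau> ` {0..K}" if "j \<le> N i" for j
      unfolding assms(10) using i that by blast
  qed (use assms(4,7-9,13) i in auto)
  have U: "emeasure M Obs \<noteq> 0" "emeasure M Obs \<noteq> \<infinity>"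
    using pos by (auto simp: emeasure_eq_measure)
  interpret U: prob_space ?U by (rule prob_space_uniform_measure[OF U])
  have count_int: "integrable ?U (trans_count \<tau> (X i) k g h)"
    and risk_int: "integrable ?U (at_risk \<tau> (X i) k g)" if "i \<in> {1..n}" "k \<in> {1..K}" for i k g h
  proof -
    show "integrable ?U (trans_count \<tau> (X i) k g h)"
      using observed_subject.trans_count_measurable[OF subject[OF that(1)] that(2)]
      by (intro U.integrable_const_bound[of _ 1]) (auto simp: trans_count_def)
    show "integrable ?U (at_risk \<tau> (X i) k g)"
      using observed_subject.at_risk_measurable[OF subject[OF that(1)] that(2)]
      by (intro U.integrable_const_bound[of _ 1]) (auto simp: at_risk_def)
  qed
  have total_int: "integrable ?U (total_count \<tau> n X k g h)" "integrable ?U (total_at_risk \<tau> n X k g)"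
    if "k \<in> {1..K}" for k g h
    using count_int risk_int that by (auto simp: total_count_def[abs_def] total_at_risk_def[abs_def])
  have total_nonneg: "0 \<le> total_count \<tau> n X k g h \<omega>" "0 \<le> total_at_risk \<tau> n X k g \<omega>" for k g h \<omega>
    by (auto simp: total_count_def total_at_risk_def trans_count_def at_risk_def intro!: sum_nonneg)
  \<comment> \<open>The upper bound makes \<open>ext_ln\<close> nonpositive. It follows from the row
    sum because an edge of an acyclic graph has \<open>g \<noteq> h\<close>.\<close>
  have jump_bounds: "0 \<le> \<alpha> k g h" "\<alpha> k g h \<le> 1" if k: "k \<in> {1..K}" and gh: "(g, h) \<in> V" for k g h
  proof -
    show nonneg: "0 \<le> \<alpha> k g h" using jumps k by (auto simp: valid_jumps_def)
    have "g \<noteq> h" using \<open>acyclic V\<close> gh by (auto simp: acyclic_def)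
    then have "\<alpha> k g h \<le> (\<Sum>h\<in>UNIV - {g}. \<alpha> k g h)"
      using jumps k by (intro member_le_sum) (auto simp: valid_jumps_def)
    also have "\<dots> \<le> 1" using jumps k by (auto simp: valid_jumps_def)
    finally show "\<alpha> k g h \<le> 1" .
  qed
  \<comment> \<open>The sums over bins and transitions are merged into one sum over
    \<open>{1..K} \<times> V\<close>, the form in which linearity is available.\<close>
  have loglik: "ereal_expectation ?U (\<lambda>\<omega>. \<Sum>(k, g, h)\<in>{1..K} \<times> V.
      ereal (total_count \<tau> n X k g h \<omega>) * ext_ln (\<alpha> k g h) - ereal (\<alpha> k g h * total_at_risk \<tau> n X k g \<omega>)) =
    (\<Sum>(k, g, h)\<in>{1..K} \<times> V. ereal (U.expectation (total_count \<tau> n X k g h)) * ext_ln (\<alpha> k g h)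
      - ereal (\<alpha> k g h * U.expectation (total_at_risk \<tau> n X k g)))"
    using jump_bounds total_int total_nonneg
      U.ereal_expectation_sum_nonpos[of "{1..K} \<times> V" "\<lambda>(k, g, h). ext_ln (\<alpha> k g h)" "\<lambda>(k, g, h). \<alpha> k g h"
        "\<lambda>(k, g, h). total_count \<tau> n X k g h" "\<lambda>(k, g, h). total_at_risk \<tau> n X k g"]
    by (auto simp: ext_ln_def case_prod_unfold)
  have reduce: "cond_expect M Obs (\<lambda>\<omega>. of_bool (e (left_state (\<lambda>u. X i u \<omega>) (\<tau> k)) (X i (\<tau> k) \<omega>))) =
      prob ({\<omega>\<in>space M. e (left_state (\<lambda>u. X i u \<omega>) (\<tau> k)) (X i (\<tau> k) \<omega>)} \<inter> ?B i) / prob (?B i)"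
    and obs_pos: "0 < prob (?B i)" if i: "i \<in> {1..n}" and k: "k \<in> {1..K}" for i k e
  proof -
    interpret S: observed_subject M \<tau> K "X i" \<alpha>' V E "W i" "N i" "t i" "x i" by (rule subject[OF i])
    let ?A = "{\<omega>\<in>space M. e (left_state (\<lambda>u. X i u \<omega>) (\<tau> k)) (X i (\<tau> k) \<omega>)}"
    \<comment> \<open>The index set contains \<open>i\<close>; an empty intersection would be the
      whole type instead of \<open>space M\<close>.\<close>
    have Obs: "Obs = (\<Inter>j\<in>{1..n}. ?B j)"
      using i by (auto simp: Obs_def obs_subject_def obs_history_def)
    have B: "?B j \<in> subject_events M (X j) (W j) (N j)" if "j \<in> {1..n}" for j
      using observed_subject.observed_subject_events[OF subject[OF that]] .
    note indep = indep_sets_cond_prob[OF assms(12) finite_atLeastAtMost i B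
        S.bin_event_Int_observed[OF k, of e] pos[unfolded Obs]]
    have "?A \<in> events"
      using S.bin_event_process_events[OF k, of e] S.process_events_subset by auto
    then show "cond_expect M Obs (\<lambda>\<omega>. of_bool (e (left_state (\<lambda>u. X i u \<omega>) (\<tau> k)) (X i (\<tau> k) \<omega>))) =
        prob (?A \<inter> ?B i) / prob (?B i)"
      using cond_expect_of_bool[OF _ pos, of "\<lambda>\<omega>. e (left_state (\<lambda>u. X i u \<omega>) (\<tau> k)) (X i (\<tau> k) \<omega>)"]
        indep(1) by (simp only: Obs)
    show "0 < prob (?B i)" using indep(2) .
  qed
  have reduce_count: "cond_expect M Obs (trans_count \<tau> (X i) k g h) =
      prob ({\<omega>\<in>space M. left_state (\<lambda>u. X i u \<omega>) (\<tau> k) = g \<and> X i (\<tau> k) \<omega> = h} \<inter> ?B i) / prob (?B i)"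
    and reduce_risk: "cond_expect M Obs (at_risk \<tau> (X i) k g) =
      prob ({\<omega>\<in>space M. left_state (\<lambda>u. X i u \<omega>) (\<tau> k) = g} \<inter> ?B i) / prob (?B i)"
    if "i \<in> {1..n}" "k \<in> {1..K}" for i k g h
    using reduce[OF that, of "\<lambda>u v. u = g \<and> v = h"] reduce[OF that, of "\<lambda>u v. u = g"]
    by (simp_all add: trans_count_def[abs_def] at_risk_def[abs_def])
  show ?thesis
  proof (intro conjI, goal_cases)
    case 1
    show ?case
      using loglik by (simp add: ereal_cond_expect_def cond_expect_def complete_loglik_def[abs_def]
        sum.cartesian_product case_prod_unfold)
  next
    case 2
    show ?case
      using count_int risk_int
      by (auto simp: cond_expect_def total_count_def[abs_def] total_at_risk_def[abs_def]
        intro!: Bochner_Integration.integral_sum)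
  next
    case 3
    show ?case
    proof (intro ballI impI, goal_cases)
      case (1 k i)
      then show ?case
        using observed_subject.cond_prob_bin[OF subject, of i k] obs_pos[of i k]
        by (simp only: reduce_count reduce_risk P_def)
    qed
  qed
qed

end
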